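(* Let $V^{[*]}$ be a dg vertex operator algebra. The map $$\eta_{F^\bullet}:R^{[*]}(V^{[*]})\to\operatorname{gr}^{[*]}A(V^{[*]}),\qquad u+C_2^{[|u|]}(V^{[*]})\mapsto u+O(V^{[*]})+\bigoplus_{p<|u|}V^{[p]}\quad(u\text{ dg homogeneous}),$$ is a surjective morphism of dg Poisson algebras.
   Context: All vector spaces are over $\mathbb C$. A (cochain) complex $V^{[*]}=\bigoplus_{p\in\mathbb Z}V^{[p]}$ has a differential $d_V$ of degree $+1$ with $d_V^2=0$; $|v|=p$ for $v\in V^{[p]}$ (dg homogeneous elements). $\operatorname{End}^{[*]}(V^{[*]})=\bigoplus_p\operatorname{End}^{[p]}(V^{[*]})$, where $\operatorname{End}^{[p]}$ is the space of linear maps of degree $p$. A dg vertex algebra $(V^{[*]},d_V,Y(\cdot,x),\mathbf 1)$ is a complex with a linear map $v\mapsto Y(v,x)=\sum_{n\in\mathbb Z}v_nx^{-n-1}\in\operatorname{End}^{[*]}(V^{[*]})[[x,x^{-1}]]$ such that for $v\in V^{[p]}$ one has $v_n\in\operatorname{End}^{[p-2n-2]}(V^{[*]})$ and $(d_Vv)_n=d_V\circ v_n-(-1)^{p}v_n\circ d_V$, and a vector $\mathbf 1\in V^{[0]}$ with $d_V\mathbf 1=0$, such that: $u_nv=0$ for $n$ sufficiently large; $Y(\mathbf 1,x)=\operatorname{id}$; $Y(v,x)\mathbf 1\in V^{[*]}[[x]]$ with constant term $v$; and (Jacobi identity) for homogeneous $u,v$ and all $l,m,n\in\mathbb Z$,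 $$\sum_{i\ge0}(-1)^i\binom li\left(u_{m+l-i}v_{n+i}-(-1)^{l}(-1)^{|u||v|}v_{n+l-i}u_{m+i}\right)=\sum_{i\ge0}\binom mi(u_{l+i}v)_{m+n-i}.$$ A dg vertex operator algebra is a dg vertex algebra with $\omega\in V^{[4]}$, $d_V\omega=0$, such that, writing $Y(\omega,x)=\sum_nL(n)x^{-n-2}$: $[L(m),L(n)]=(m-n)L(m+n)+\frac1{12}(m^3-m)\delta_{m+n,0}c_V$ for some $c_V\in\mathbb C$; $L(0)$ is semisimple with $V^{[*]}=\bigoplus_{n\in\frac12\mathbb Z}V_n^{[*]}$, $V_n^{[*]}$ the eigenspace of eigenvalue (weight) $n$, $\omega\in V_2^{[*]}$, $\dim V_n^{[*]}<\infty$, $V_n^{[*]}=0$ for $n\ll0$; and $L(-1)v=v_{-2}\mathbf 1$. Write $\operatorname{wt}(u)=n$ for $u\in V_n^{[*]}$. $C_2$-algebra: $C_2^{[*]}(V^{[*]})=\operatorname{Span}\{u_{-2}v\}$ (graded subcomplex, with degree $p$ part $C_2^{[p]}(V^{[*]})$), $R^{[*]}(V^{[*]})=V^{[*]}/C_2^{[*]}(V^{[*]})$, a graded commutative dg Poisson algebra with product $\overline u\cdot\overline v=\overline{u_{-1}v}$, bracket $\{\overline u,\overline v\}=\overline{u_0v}$ of degree $-2$, and differential induced by $d_V$. Zhu algebra: for $u$ weight homogeneous (extended linearly in $u$), $u\ast v=\sum_{n\ge0}\binom{\operatorname{wt}(u)}{n}u_{n-1}v$ and $u\circ v=\sum_{n\ge0}\binom{\operatorname{wt}(u)}{n}u_{n-2}v$.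 $O(V^{[*]})$ is the span of all $u\circ v$, and $A(V^{[*]})=V^{[*]}/O(V^{[*]})$, an associative algebra under $\ast$; $[v]$ denotes the class of $v$. $F^pA(V^{[*]})$ is the image of $\bigoplus_{q\le p}V^{[q]}$, $\operatorname{gr}^{[p]}A(V^{[*]})=F^pA(V^{[*]})/F^{p-1}A(V^{[*]})$, $\operatorname{gr}^{[*]}A(V^{[*]})=\bigoplus_p\operatorname{gr}^{[p]}A(V^{[*]})$. This is a graded commutative dg Poisson algebra with product induced by $\ast$, differential induced by $d_V$, and bracket $\operatorname{gr}^{[p]}\times\operatorname{gr}^{[q]}\to\operatorname{gr}^{[p+q-2]}$ given on classes of $u\in V^{[p]}$, $v\in V^{[q]}$ by $[u]\ast[v]-(-1)^{pq}[v]\ast[u]\bmod F^{p+q-3}A(V^{[*]})$. A morphism of dg Poisson algebras is a degree-$0$ chain map preserving products and brackets. (Dg Poisson algebra with bracket of even degree: associative dg algebra with a bracket satisfying graded skew symmetry, graded Jacobi, $\{a,bc\}=\{a,b\}c+(-1)^{|a||b|}b\{a,c\}$ and $d\{a,b\}=\{da,b\}+(-1)^{|a|}\{a,db\}$.) *)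

theory Defs
  imports
    "HOL-Algebra.Algebraic_Closure_Type"
    "HOL-Library.Set_Algebras"
    "HOL-Library.Groups_Big_Fun"
begin

section \<open>Dg Poisson algebras\<close>

text \<open>
  Quotients by subspaces that depend on term parameters are not types, so graded algebras
  are records with an explicit carrier. The record extends the record of modules;
  the homogeneous part of degree \<open>p\<close> is \<open>hpart P p\<close>.
\<close>

record 'a dg_poisson = "(complex, 'a) module" +
  hpart :: "int \<Rightarrow> 'a set"
  dgdiff :: "'a \<Rightarrow> 'a"
  pbracket :: "'a \<Rightarrow> 'a \<Rightarrow> 'a"

text \<open>The bracket has even degree \<open>k\<close>; associative algebras have a unit.\<close>

locale dg_poisson_algebra =
  Module.module "ring_of_type_algebra :: complex ring" P + ring P
  for k :: int and P :: "('a, 'b) dg_poisson_scheme" (structure) +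
  assumes even_k: "even k"
    and mult_smult_left:
      "\<lbrakk>x \<in> carrier P; y \<in> carrier P\<rbrakk> \<Longrightarrow> (c \<odot> x) \<otimes> y = c \<odot> (x \<otimes> y)"
    and mult_smult_right:
      "\<lbrakk>x \<in> carrier P; y \<in> carrier P\<rbrakk> \<Longrightarrow> x \<otimes> (c \<odot> y) = c \<odot> (x \<otimes> y)"
    and hpart_submodule: "submodule (hpart P p) (ring_of_type_algebra :: complex ring) P"
    and hpart_direct_sum: "x \<in> carrier P \<Longrightarrow>
      \<exists>!f. (\<forall>p. f p \<in> hpart P p) \<and> finite {p. f p \<noteq> \<zero>} \<and> x = finsum P f {p. f p \<noteq> \<zero>}"
    and mult_degree:
      "\<lbrakk>x \<in> hpart P p; y \<in> hpart P q\<rbrakk> \<Longrightarrow> x \<otimes> y \<in> hpart P (p + q)"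
    and diff_closed: "x \<in> carrier P \<Longrightarrow> dgdiff P x \<in> carrier P"
    and diff_add:
      "\<lbrakk>x \<in> carrier P; y \<in> carrier P\<rbrakk> \<Longrightarrow> dgdiff P (x \<oplus> y) = dgdiff P x \<oplus> dgdiff P y"
    and diff_smult: "x \<in> carrier P \<Longrightarrow> dgdiff P (c \<odot> x) = c \<odot> dgdiff P x"
    and diff_degree: "x \<in> hpart P p \<Longrightarrow> dgdiff P x \<in> hpart P (p + 1)"
    and diff_diff: "x \<in> carrier P \<Longrightarrow> dgdiff P (dgdiff P x) = \<zero>"
    and diff_mult: "\<lbrakk>x \<in> hpart P p; y \<in> hpart P q\<rbrakk> \<Longrightarrow>
      dgdiff P (x \<otimes> y) = dgdiff P x \<otimes> y \<oplus> ((-1) powi p) \<odot> (x \<otimes> dgdiff P y)"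
    and bracket_closed:
      "\<lbrakk>x \<in> carrier P; y \<in> carrier P\<rbrakk> \<Longrightarrow> pbracket P x y \<in> carrier P"
    and bracket_add_left: "\<lbrakk>x \<in> carrier P; y \<in> carrier P; z \<in> carrier P\<rbrakk> \<Longrightarrow>
      pbracket P (x \<oplus> y) z = pbracket P x z \<oplus> pbracket P y z"
    and bracket_add_right: "\<lbrakk>x \<in> carrier P; y \<in> carrier P; z \<in> carrier P\<rbrakk> \<Longrightarrow>
      pbracket P x (y \<oplus> z) = pbracket P x y \<oplus> pbracket P x z"
    and bracket_smult_left:
      "\<lbrakk>x \<in> carrier P; y \<in> carrier P\<rbrakk> \<Longrightarrow> pbracket P (c \<odot> x) y = c \<odot> pbracket P x y"
    and bracket_smult_right:
      "\<lbrakk>x \<in> carrier P; y \<in> carrier P\<rbrakk> \<Longrightarrow> pbracket P x (c \<odot> y) = c \<odot> pbracket P x y"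
    and bracket_degree:
      "\<lbrakk>x \<in> hpart P p; y \<in> hpart P q\<rbrakk> \<Longrightarrow> pbracket P x y \<in> hpart P (p + q + k)"
    and bracket_skew: "\<lbrakk>x \<in> hpart P p; y \<in> hpart P q\<rbrakk> \<Longrightarrow>
      pbracket P x y = \<ominus> (((-1) powi (p * q)) \<odot> pbracket P y x)"
    and bracket_jacobi: "\<lbrakk>x \<in> hpart P p; y \<in> hpart P q; z \<in> hpart P r\<rbrakk> \<Longrightarrow>
      pbracket P x (pbracket P y z) =
        pbracket P (pbracket P x y) z \<oplus> ((-1) powi (p * q)) \<odot> pbracket P y (pbracket P x z)"
    and bracket_mult: "\<lbrakk>x \<in> hpart P p; y \<in> hpart P q; z \<in> hpart P r\<rbrakk> \<Longrightarrow>
      pbracket P x (y \<otimes> z) =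
        pbracket P x y \<otimes> z \<oplus> ((-1) powi (p * q)) \<odot> (y \<otimes> pbracket P x z)"
    and diff_bracket: "\<lbrakk>x \<in> hpart P p; y \<in> hpart P q\<rbrakk> \<Longrightarrow>
      dgdiff P (pbracket P x y) =
        pbracket P (dgdiff P x) y \<oplus> ((-1) powi p) \<odot> pbracket P x (dgdiff P y)"

locale dg_poisson_morphism =
  source: dg_poisson_algebra k P + target: dg_poisson_algebra k Q
  for k :: int and P :: "('a, 'm) dg_poisson_scheme" and Q :: "('b, 'n) dg_poisson_scheme"
    and h :: "'a \<Rightarrow> 'b" +
  assumes ring_hom: "h \<in> ring_hom P Q"
    and smult: "x \<in> carrier P \<Longrightarrow> h (c \<odot>\<^bsub>P\<^esub> x) = c \<odot>\<^bsub>Q\<^esub> h x"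
    and degree: "h ` hpart P p \<subseteq> hpart Q p"
    and chain_map: "x \<in> carrier P \<Longrightarrow> h (dgdiff P x) = dgdiff Q (h x)"
    and bracket: "\<lbrakk>x \<in> carrier P; y \<in> carrier P\<rbrakk> \<Longrightarrow>
      h (pbracket P x y) = pbracket Q (h x) (h y)"


section \<open>Direct sums of subspaces\<close>

definition decomposes :: "('i \<Rightarrow> 'b::comm_monoid_add set) \<Rightarrow> 'b \<Rightarrow> ('i \<Rightarrow> 'b) \<Rightarrow> bool" where
  "decomposes W v f \<longleftrightarrow>
    (\<forall>i. f i \<in> W i) \<and> finite {i. f i \<noteq> 0} \<and> v = (\<Sum>i | f i \<noteq> 0. f i)"

definition direct_sum :: "('i \<Rightarrow> 'b::comm_monoid_add set) \<Rightarrow> bool" where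
  "direct_sum W \<longleftrightarrow> (\<forall>v. \<exists>!f. decomposes W v f)"

definition component :: "('i \<Rightarrow> 'b::comm_monoid_add set) \<Rightarrow> 'b \<Rightarrow> 'i \<Rightarrow> 'b" where
  "component W v = (THE f. decomposes W v f)"


section \<open>Dg vertex algebras\<close>

text \<open>
  \<open>Y u n\<close> is the mode \<open>u\<^sub>n\<close>, i.e. the coefficient of \<open>x\<^sup>-\<^sup>n\<^sup>-\<^sup>1\<close> in \<open>Y(u,x)\<close>; \<open>deg p\<close> is the
  space of vectors of cohomological degree \<open>p\<close>. In the Jacobi identity both sides are
  applied to a vector \<open>w\<close>; then only finitely many terms are nonzero by truncation, so that
  \<^term>\<open>Sum_any\<close> is the intended sum.
\<close>

locale dg_vertex_algebra = vector_space scale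
  for scale :: "complex \<Rightarrow> 'v::ab_group_add \<Rightarrow> 'v" (infixr \<open>*s\<close> 75) +
  fixes deg :: "int \<Rightarrow> 'v set"
    and d :: "'v \<Rightarrow> 'v"
    and Y :: "'v \<Rightarrow> int \<Rightarrow> 'v \<Rightarrow> 'v"
    and vac :: 'v
  assumes deg_subspace: "subspace (deg p)"
    and deg_direct_sum: "direct_sum deg"
    and d_linear: "Vector_Spaces.linear scale scale d"
    and d_degree: "v \<in> deg p \<Longrightarrow> d v \<in> deg (p + 1)"
    and d_d: "d (d v) = 0"
    and Y_linear_left: "Vector_Spaces.linear scale scale (\<lambda>v. Y v n w)"
    and Y_linear_right: "Vector_Spaces.linear scale scale (Y v n)"
    and Y_degree: "\<lbrakk>v \<in> deg p; w \<in> deg q\<rbrakk> \<Longrightarrow> Y v n w \<in> deg (q + (p - 2 * n - 2))"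
    and Y_d: "v \<in> deg p \<Longrightarrow> Y (d v) n w = d (Y v n w) - ((-1) powi p) *s Y v n (d w)"
    and vac_degree: "vac \<in> deg 0"
    and vac_d: "d vac = 0"
    and truncation: "\<exists>N. \<forall>n\<ge>N. Y u n v = 0"
    and vacuum: "Y vac n v = (if n = -1 then v else 0)"
    and creation_regular: "n \<ge> 0 \<Longrightarrow> Y v n vac = 0"
    and creation_constant: "Y v (-1) vac = v"
    and jacobi: "\<lbrakk>u \<in> deg p; v \<in> deg q\<rbrakk> \<Longrightarrow>
      Sum_any (\<lambda>i::nat. ((-1) ^ i * (of_int l gchoose i)) *s
        (Y u (m + l - int i) (Y v (n + int i) w)
          - ((-1) powi l * (-1) powi (p * q)) *s Y v (n + l - int i) (Y u (m + int i) w)))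
      = Sum_any (\<lambda>i::nat. (of_int m gchoose i) *s Y (Y u (l + int i) v) (m + n - int i) w)"
begin


subsection \<open>The algebra R(V)\<close>

definition C2 :: "'v set" where
  "C2 = span {Y u (-2) v | u v. True}"

definition R_class :: "'v \<Rightarrow> 'v set" where
  "R_class u = u +o C2"

text \<open>
  An operation induced on a quotient sends cosets to the union of the classes of the results
  over all representatives; if it is well defined, all these classes coincide. The sum of
  cosets is the sum of sets. The degree \<open>p\<close> part \<open>V\<^sup>p / C\<^sub>2\<^sup>p\<close> is the image of \<open>V\<^sup>p\<close>
  in \<open>V / C\<^sub>2\<close>.
\<close>

definition R_algebra :: "'v set dg_poisson" where
  "R_algebra = \<lparr>
     carrier = range R_class,
     monoid.mult = (\<lambda>S S'. \<Union>u\<in>S. \<Union>v\<in>S'. R_class (Y u (-1) v)),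
     one = R_class vac,
     ring.zero = C2,
     add = (+),
     module.smult = (\<lambda>c S. \<Union>u\<in>S. R_class (c *s u)),
     hpart = (\<lambda>p. R_class ` deg p),
     dgdiff = (\<lambda>S. \<Union>u\<in>S. R_class (d u)),
     pbracket = (\<lambda>S S'. \<Union>u\<in>S. \<Union>v\<in>S'. R_class (Y u 0 v))\<rparr>"

end


section \<open>Dg vertex operator algebras\<close>

locale dg_vertex_operator_algebra = dg_vertex_algebra scale deg d Y vac
  for scale :: "complex \<Rightarrow> 'v::ab_group_add \<Rightarrow> 'v" (infixr \<open>*s\<close> 75)
    and deg :: "int \<Rightarrow> 'v set"
    and d :: "'v \<Rightarrow> 'v"
    and Y :: "'v \<Rightarrow> int \<Rightarrow> 'v \<Rightarrow> 'v"
    and vac :: 'v +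
  fixes \<omega> :: 'v
  assumes omega_degree: "\<omega> \<in> deg 4"
    and omega_d: "d \<omega> = 0"
    and virasoro: "\<exists>c_V::complex. \<forall>m n v.
      Y \<omega> (m + 1) (Y \<omega> (n + 1) v) - Y \<omega> (n + 1) (Y \<omega> (m + 1) v) =
        of_int (m - n) *s Y \<omega> (m + n + 1) v
        + (if m + n = 0 then (of_int (m ^ 3 - m) / 12 * c_V) *s v else 0)"
    and weight_direct_sum: "direct_sum (\<lambda>k::int. {v. Y \<omega> 1 v = (of_int k / 2) *s v})"
    and omega_weight: "Y \<omega> 1 \<omega> = 2 *s \<omega>"
    and weight_finite_dim:
      "\<exists>B. finite B \<and> span B = {v. Y \<omega> 1 v = (of_int k / 2) *s v}"
    and weight_bounded_below:
      "\<exists>N. \<forall>k<N. {v. Y \<omega> 1 v = (of_int k / 2) *s v} = {0}"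
    and translation: "Y \<omega> 0 v = Y v (-2) vac"
begin

text \<open>\<open>weight_space k\<close> has weight \<open>k / 2\<close>, as weights are half integers.\<close>

definition weight_space :: "int \<Rightarrow> 'v set" where
  "weight_space k = {v. Y \<omega> 1 v = (of_int k / 2) *s v}"


subsection \<open>The Zhu algebra\<close>

definition zhu_mult :: "'v \<Rightarrow> 'v \<Rightarrow> 'v" where
  "zhu_mult u v = Sum_any (\<lambda>k::int. Sum_any (\<lambda>n::nat.
     ((of_int k / 2) gchoose n) *s Y (component weight_space u k) (int n - 1) v))"

definition zhu_circ :: "'v \<Rightarrow> 'v \<Rightarrow> 'v" where
  "zhu_circ u v = Sum_any (\<lambda>k::int. Sum_any (\<lambda>n::nat.
     ((of_int k / 2) gchoose n) *s Y (component weight_space u k) (int n - 2) v))"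

definition zhu_O :: "'v set" where
  "zhu_O = span {zhu_circ u v | u v. True}"

definition A_class :: "'v \<Rightarrow> 'v set" where
  "A_class u = u +o zhu_O"

definition A_mult :: "'v set \<Rightarrow> 'v set \<Rightarrow> 'v set" where
  "A_mult S S' = (\<Union>u\<in>S. \<Union>v\<in>S'. A_class (zhu_mult u v))"

definition A_smult :: "complex \<Rightarrow> 'v set \<Rightarrow> 'v set" where
  "A_smult c S = (\<Union>u\<in>S. A_class (c *s u))"

definition A_diff :: "'v set \<Rightarrow> 'v set" where
  "A_diff S = (\<Union>u\<in>S. A_class (d u))"

definition A_filt :: "int \<Rightarrow> 'v set set" where
  "A_filt p = A_class ` span (\<Union>q\<in>{..p}. deg q)"


subsection \<open>The associated graded algebra gr A(V)\<close>

text \<open>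
  \<open>gr_part p\<close> is the quotient of \<open>A_filt p\<close> by \<open>A_filt (p - 1)\<close>; its elements are cosets in
  \<open>A(V)\<close>, and its zero is \<open>A_filt (p - 1)\<close>.
\<close>

definition gr_part :: "int \<Rightarrow> 'v set set set" where
  "gr_part p = (\<lambda>a. a +o A_filt (p - 1)) ` A_filt p"

definition gr_class :: "int \<Rightarrow> 'v \<Rightarrow> 'v set set" where
  "gr_class p u = A_class u +o A_filt (p - 1)"

definition gr_part_mult :: "int \<Rightarrow> int \<Rightarrow> 'v set set \<Rightarrow> 'v set set \<Rightarrow> 'v set set" where
  "gr_part_mult p q S S' = (\<Union>a\<in>S. \<Union>b\<in>S'. A_mult a b +o A_filt (p + q - 1))"

definition gr_part_bracket :: "int \<Rightarrow> int \<Rightarrow> 'v set set \<Rightarrow> 'v set set \<Rightarrow> 'v set set" where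
  "gr_part_bracket p q S S' =
    (\<Union>u\<in>{u \<in> deg p. gr_class p u = S}. \<Union>v\<in>{v \<in> deg q. gr_class q v = S'}.
      (A_mult (A_class u) (A_class v)
        + A_smult (- ((-1) powi (p * q))) (A_mult (A_class v) (A_class u)))
      +o A_filt (p + q - 3))"

definition gr_part_diff :: "int \<Rightarrow> 'v set set \<Rightarrow> 'v set set" where
  "gr_part_diff p S = (\<Union>a\<in>S. A_diff a +o A_filt p)"

definition gr_part_smult :: "int \<Rightarrow> complex \<Rightarrow> 'v set set \<Rightarrow> 'v set set" where
  "gr_part_smult p c S = (\<Union>a\<in>S. A_smult c a +o A_filt (p - 1))"

text \<open>
  The direct sum of all \<open>gr_part p\<close> consists of families indexed by degree with finite
  support, and the operations on the parts are extended bilinearly. Since a sum of sets over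
  the empty index set is \<open>{0}\<close> and not the zero coset, the zero coset is added explicitly.
\<close>

definition gr_zero :: "int \<Rightarrow> 'v set set" where
  "gr_zero p = A_filt (p - 1)"

definition gr_inj :: "int \<Rightarrow> 'v set set \<Rightarrow> int \<Rightarrow> 'v set set" where
  "gr_inj p S = gr_zero(p := S)"

definition gr_algebra :: "(int \<Rightarrow> 'v set set) dg_poisson" where
  "gr_algebra = \<lparr>
     carrier = {f. (\<forall>p. f p \<in> gr_part p) \<and> finite {p. f p \<noteq> gr_zero p}},
     monoid.mult = (\<lambda>f g r. gr_zero r +
       (\<Sum>p | f p \<noteq> gr_zero p. gr_part_mult p (r - p) (f p) (g (r - p)))),
     one = gr_inj 0 (gr_class 0 vac),
     ring.zero = gr_zero,
     add = (\<lambda>f g p. f p + g p),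
     module.smult = (\<lambda>c f p. gr_part_smult p c (f p)),
     hpart = (\<lambda>p. gr_inj p ` gr_part p),
     dgdiff = (\<lambda>f p. gr_part_diff (p - 1) (f (p - 1))),
     pbracket = (\<lambda>f g r. gr_zero r +
       (\<Sum>p | f p \<noteq> gr_zero p. gr_part_bracket p (r + 2 - p) (f p) (g (r + 2 - p))))\<rparr>"


subsection \<open>The map from R(V) to gr A(V)\<close>

text \<open>
  The linear extension of the map sending the class of \<open>u\<close>, for \<open>u\<close> of degree \<open>p\<close>, to
  \<open>gr_inj p (gr_class p u)\<close>.
\<close>

definition eta :: "'v set \<Rightarrow> int \<Rightarrow> 'v set set" where
  "eta S = (\<lambda>p. \<Union>u\<in>S. gr_class p (component deg u p))"

end

end

theory Submission
  imports Defs "HOL-Computational_Algebra.Formal_Power_Series"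
begin

text \<open>
  Both quotients in the statement belong to one family. For a complex number \<open>h\<close> deform the
  fields to \<open>Y\<^sub>h(u,x) = (1 + h x)\<^bsup>wt u\<^esup> Y(u,x)\<close> and let \<open>J\<^sub>h\<close> be the span of the products of index
  \<open>-2\<close> of \<open>Y\<^sub>h\<close>. Then \<open>V / J\<^sub>0\<close> is \<open>R(V)\<close> and \<open>V / J\<^sub>1\<close> is \<open>A(V)\<close>, both with the product of index
  \<open>-1\<close>. The deformed products satisfy a Jacobi identity in which only the right hand side changes:
  the weight of \<open>u\<^sub>n v\<close> is \<open>wt u + wt v - n - 1\<close>, so that the factors on the two sides differ by a
  power of \<open>1 + h x\<close> (\<open>zhu_prod_jacobi\<close> for \<open>h = 1\<close>). This identity alone shows that \<open>J\<^sub>h\<close> is a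
  two-sided ideal and that, for \<open>u\<close>, \<open>v\<close> of degrees \<open>p\<close>, \<open>q\<close>, the supercommutator
  \<open>u * v - (-1)\<^bsup>pq\<^esup> v * u\<close> equals \<open>h\<close> times the product of index \<open>0\<close>, up to \<open>J\<^sub>h\<close> and products of
  positive index (\<open>supercommutator_mod_J\<close>). The weights may be half integers throughout, because
  the binomial identities involved hold for complex exponents.

  The degree of \<open>u\<^sub>n v\<close> drops by two when \<open>n\<close> grows by one, so the deformation changes a product
  only in lower degrees (\<open>zhu_prod_degree\<close>). Therefore the map that sends \<open>u\<close> to the family of
  classes of its homogeneous components in \<open>gr A(V)\<close> carries \<open>u\<^bsub>-1\<^esub> v\<close>, \<open>u\<^sub>0 v\<close> and \<open>d u\<close> to product,
  bracket and differential. It is surjective, and it kills \<open>C\<^sub>2\<close>, as the leading term of \<open>u \<circ> v\<close> is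
  \<open>u\<^bsub>-2\<^esub> v\<close>. The dg Poisson identities hold in \<open>V\<close> modulo \<open>C\<^sub>2\<close>, so each surjection from \<open>V\<close> with these
  properties transports them to its target (locale \<open>poisson_quotient\<close>). Used for \<open>V \<rightarrow> R(V)\<close> and for
  \<open>V \<rightarrow> gr A(V)\<close> this shows that source and target of the map in question are dg Poisson algebras;
  the second map is the composition of \<open>\<eta>\<close> with the first, hence \<open>\<eta>\<close> is a surjective morphism.

  The bracket of \<open>gr A(V)\<close> needs care. Two representatives of one class differ by an element of
  \<open>O(V)\<close> and one of lower degree; they need not be homogeneous, so the sign in the supercommutator has no
  meaning for them. The supercommutator with \<open>v\<close> is therefore extended linearly, by means of an
  operator that multiplies each homogeneous component with its sign and preserves \<open>O(V)\<close>
  (\<open>supercommutator_O_Filt\<close>).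
\<close>

section \<open>Components in a direct sum of subspaces\<close>

locale graded_vector_space = vector_space scale
  for scale :: "'k::field \<Rightarrow> 'v::ab_group_add \<Rightarrow> 'v" (infixr \<open>*s\<close> 75) +
  fixes W :: "'i \<Rightarrow> 'v set"
  assumes W_subspace: "subspace (W i)"
    and W_direct: "direct_sum W"
begin

lemma decomposes_component: "decomposes W v (component W v)"
  unfolding component_def using W_direct unfolding direct_sum_def by (metis theI')

lemma component_eqI: "decomposes W v f \<Longrightarrow> component W v = f"
  using W_direct decomposes_component unfolding direct_sum_def by blast

lemma component_in: "component W v i \<in> W i"
  and finite_component: "finite {i. component W v i \<noteq> 0}"
  and sum_component: "(\<Sum>i | component W v i \<noteq> 0. component W v i) = v"
  using decomposes_component[of v] unfolding decomposes_def by auto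

lemma sum_component_superset:
  assumes "finite A" "{i. component W v i \<noteq> 0} \<subseteq> A"
  shows "(\<Sum>i\<in>A. component W v i) = v"
proof -
  have "(\<Sum>i\<in>A. component W v i) = (\<Sum>i | component W v i \<noteq> 0. component W v i)"
    by (rule sum.mono_neutral_right) (use assms in auto)
  then show ?thesis by (simp add: sum_component)
qed

lemma component_superset_eqI:
  assumes "finite A" "\<And>i. f i \<in> W i" "\<And>i. i \<notin> A \<Longrightarrow> f i = 0" "v = sum f A"
  shows "component W v = f"
proof (rule component_eqI)
  have "{i. f i \<noteq> 0} \<subseteq> A" using assms(3) by auto
  moreover from this have "sum f A = sum f {i. f i \<noteq> 0}"
    by (intro sum.mono_neutral_right) (use assms(1) in auto)
  ultimately show "decomposes W v f"
    unfolding decomposes_def using assms finite_subset by blast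
qed

lemma component_add: "component W (u + v) i = component W u i + component W v i"
proof -
  let ?A = "{i. component W u i \<noteq> 0} \<union> {i. component W v i \<noteq> 0}"
  have fin: "finite ?A" by (simp add: finite_component)
  have "component W (u + v) = (\<lambda>i. component W u i + component W v i)"
  proof (rule component_superset_eqI[OF fin])
    show "component W u i + component W v i \<in> W i" for i
      by (simp add: subspace_add[OF W_subspace] component_in)
    show "u + v = (\<Sum>i\<in>?A. component W u i + component W v i)"
      by (simp add: sum.distrib sum_component_superset[OF fin])
  qed auto
  then show ?thesis by simp
qed

lemma component_scale: "component W (c *s v) i = c *s component W v i"
proof -
  let ?A = "{i. component W v i \<noteq> 0}"
  have "component W (c *s v) = (\<lambda>i. c *s component W v i)"
  proof (rule component_superset_eqI[OF finite_component])
    show "c *s component W v i \<in> W i" for i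
      by (simp add: subspace_scale[OF W_subspace] component_in)
    show "c *s v = (\<Sum>i\<in>?A. c *s component W v i)"
      by (simp add: sum_component flip: scale_sum_right)
  qed auto
  then show ?thesis by simp
qed

lemma component_0: "component W 0 i = 0"
  using component_scale[of 0 0 i] by simp

lemma component_diff: "component W (u - v) i = component W u i - component W v i"
  using component_add[of "u - v" v i] by simp

lemma component_sum: "component W (sum f A) i = (\<Sum>a\<in>A. component W (f a) i)"
  by (induction A rule: infinite_finite_induct) (auto simp: component_0 component_add)

lemma component_homogeneous:
  assumes "v \<in> W i"
  shows "component W v j = (if j = i then v else 0)"
proof -
  have "component W v = (\<lambda>j. if j = i then v else 0)"
    by (rule component_superset_eqI[of "{i}"]) (use assms subspace_0[OF W_subspace] in auto)
  then show ?thesis by simp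
qed

lemma homogeneous_induct [case_names homogeneous add]:
  assumes hom: "\<And>i v. v \<in> W i \<Longrightarrow> Q v"
    and add: "\<And>u v. Q u \<Longrightarrow> Q v \<Longrightarrow> Q (u + v)"
  shows "Q v"
proof -
  have zero: "Q 0" using hom subspace_0[OF W_subspace] by blast
  have "Q (\<Sum>i\<in>A. component W v i)" if "finite A" for A
    using that by (induction A) (auto intro: zero add hom component_in)
  from this[OF finite_component[of v]] show ?thesis by (simp add: sum_component)
qed

end

section \<open>A one-parameter family of products\<close>

text \<open>
  \<open>P u n v\<close> stands for the product of index \<open>n\<close> of the field \<open>Y\<^sub>h(u,x)\<close>. In the Jacobi identity the inner
  sum over \<open>s\<close> is the expansion of \<open>(1 + h x)\<^bsup>l+k+1\<^esup>\<close>, the quotient of the deformation factors of both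
  sides. By truncation every sum has only finitely many nonzero terms; the bound \<open>N\<close> replaces the
  infinite sums because identities with a common large \<open>N\<close> can be added without any regard to
  supports.
\<close>

locale deformed_vertex_algebra = degree: graded_vector_space scale deg
  for scale :: "complex \<Rightarrow> 'v::ab_group_add \<Rightarrow> 'v" (infixr \<open>*s\<close> 75)
    and deg :: "int \<Rightarrow> 'v set" +
  fixes h :: complex
    and P :: "'v \<Rightarrow> int \<Rightarrow> 'v \<Rightarrow> 'v"
    and vac :: 'v
  assumes P_linear_left: "Vector_Spaces.linear scale scale (\<lambda>v. P v n w)"
    and P_linear_right: "Vector_Spaces.linear scale scale (P v n)"
    and P_truncation: "\<exists>N. \<forall>n\<ge>N. P u n v = 0"
    and vac_in_deg: "vac \<in> deg 0"
    and P_vacuum: "P vac n v = (if n = -1 then v else 0)"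
    and P_creation_regular: "n \<ge> 0 \<Longrightarrow> P v n vac = 0"
    and P_creation_constant: "P v (-1) vac = v"
    and deformed_jacobi: "\<lbrakk>u \<in> deg p; v \<in> deg q\<rbrakk> \<Longrightarrow>
      \<forall>\<^sub>F N in sequentially.
        (\<Sum>i<N. ((-1) ^ i * (of_int l gchoose i)) *s
          (P u (m + l - int i) (P v (n + int i) w)
            - ((-1) powi l * (-1) powi (p * q)) *s P v (n + l - int i) (P u (m + int i) w)))
        = (\<Sum>k<N. (of_int m gchoose k) *s (\<Sum>s<N. ((of_int (l + int k + 1) gchoose s) * h ^ s) *s
            P (P u (l + int k) v) (m + n - int k + int s) w))"
begin

lemma P_add_left: "P (u + v) n w = P u n w + P v n w"
  and P_scale_left: "P (c *s u) n w = c *s P u n w"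
  and P_add_right: "P u n (v + w) = P u n v + P u n w"
  and P_scale_right: "P u n (c *s v) = c *s P u n v"
proof -
  interpret L: Vector_Spaces.linear scale scale "\<lambda>v. P v n w" by (rule P_linear_left)
  interpret R: Vector_Spaces.linear scale scale "P u n" by (rule P_linear_right)
  show "P (u + v) n w = P u n w + P v n w" "P (c *s u) n w = c *s P u n w"
    "P u n (v + w) = P u n v + P u n w" "P u n (c *s v) = c *s P u n v"
    by (auto simp: L.add L.scale R.add R.scale)
qed

lemma P_zero_left [simp]: "P 0 n w = 0" and P_zero_right [simp]: "P u n 0 = 0"
  using P_scale_left[of 0 0 n w] P_scale_right[of u n 0 0] by auto

lemma P_diff_left: "P (u - v) n w = P u n w - P v n w"
  and P_diff_right: "P u n (v - w) = P u n v - P u n w"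
  using P_add_left[of "u - v" v n w] P_add_right[of u n "v - w" w] by auto

text \<open>
  For the products of \<open>V\<close> this is \<open>C\<^sub>2(V)\<close>, for the products deformed with \<open>h = 1\<close> it is \<open>O(V)\<close>.
\<close>

definition J :: "'v set" where
  "J = degree.span {P u (-2) v | u v. True}"

lemma subspace_J: "degree.subspace J"
  unfolding J_def by (rule degree.subspace_span)

lemmas J_add = degree.subspace_add[OF subspace_J]
  and J_diff = degree.subspace_diff[OF subspace_J]
  and J_scale = degree.subspace_scale[OF subspace_J]
  and J_zero = degree.subspace_0[OF subspace_J]
  and J_sum = degree.subspace_sum[OF subspace_J]

lemma P_minus_two_in_J: "P u (-2) v \<in> J"
  unfolding J_def by (rule degree.span_base) blast

lemma J_induct [consumes 1, case_names generator add scale]: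
  assumes "x \<in> J" "\<And>p q u v. u \<in> deg p \<Longrightarrow> v \<in> deg q \<Longrightarrow> Q (P u (-2) v)"
    "\<And>x y. Q x \<Longrightarrow> Q y \<Longrightarrow> Q (x + y)" "\<And>c x. Q x \<Longrightarrow> Q (c *s x)"
  shows "Q x"
proof -
  have gen: "Q (P u (-2) v)" for u v
  proof (induction u rule: degree.homogeneous_induct)
    case (homogeneous p u)
    then show ?case
      by (induction v rule: degree.homogeneous_induct) (use assms P_add_right in \<open>auto\<close>)
  qed (simp add: P_add_left assms)
  have zero: "Q 0" using assms(4)[OF gen, of 0] by simp
  show ?thesis
    using assms(1) unfolding J_def
    by (induction rule: degree.span_induct_alt) (auto intro: zero assms gen)
qed

text \<open>
  For \<open>l = -2\<close> and \<open>m = 0\<close> the right hand side of the Jacobi identity is the sum of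
  \<open>(-h)\<^sup>s (u\<^bsub>-2\<^esub> v)\<^bsub>n+s\<^esub> w\<close>, an expansion of \<open>(1 + h x)\<^bsup>-1\<^esup>\<close>. Adding \<open>h\<close> times the identity for \<open>n + 1\<close>
  multiplies by \<open>1 + h x\<close> and leaves the single product \<open>(u\<^bsub>-2\<^esub> v)\<^sub>n w\<close>.
\<close>

lemma minus_two_iterate:
  fixes w :: 'v
  assumes "u \<in> deg p" "v \<in> deg q"
  defines "A \<equiv> \<lambda>n i. P u (-2 - int i) (P v (n + int i) w)
    - ((-1) powi (p * q)) *s P v (n - 2 - int i) (P u (int i) w)"
  shows "\<forall>\<^sub>F N in sequentially.
    P (P u (-2) v) n w = (\<Sum>i<N. of_nat (Suc i) *s (A n i + h *s A (n + 1) i))"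
proof -
  define x where "x = P u (-2) v"
  \<comment> \<open>the coefficients of \<open>(1 - x)\<^bsup>-2\<^esup>\<close>\<close>
  have bin2: "(-1) ^ i * ((-2::complex) gchoose i) = of_nat (Suc i)" for i
  proof -
    have "((-2::complex) gchoose i) = (-1) ^ i * ((1 + of_nat i) gchoose i)"
      using gbinomial_minus[of "2::complex" i] by (simp add: algebra_simps)
    also have "((1 + of_nat i :: complex) gchoose i) = of_nat (Suc i)"
      using binomial_gbinomial[of "Suc i" i, where 'a = complex] by simp
    finally show ?thesis by (simp flip: power_add mult_2)
  qed
  have bin1: "((-1::complex) gchoose s) = (-1) ^ s" for s
    using gbinomial_minus[of "1::complex" s] binomial_gbinomial[of s s, where 'a = complex]
    by simp
  have E: "\<forall>\<^sub>F N in sequentially. (\<Sum>i<N. of_nat (Suc i) *s A n i)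
      = (\<Sum>s<N. (- h) ^ s *s P x (n + int s) w)" for n
    using deformed_jacobi[OF assms(1,2), of "-2" 0 n w] eventually_gt_at_top[of 0]
  proof eventually_elim
    case (elim N)
    have "(\<Sum>i<N. of_nat (Suc i) *s A n i) =
       (\<Sum>k<N. (0 gchoose k) *s (\<Sum>s<N. ((of_int (int k - 1) gchoose s) * h ^ s) *s
          P (P u (-2 + int k) v) (n - int k + int s) w))"
      using elim(1) by (simp add: A_def bin2)
    also have "\<dots> = (\<Sum>k\<in>{0}. (0 gchoose k) *s (\<Sum>s<N. ((of_int (int k - 1) gchoose s) * h ^ s) *s
          P (P u (-2 + int k) v) (n - int k + int s) w))"
      by (rule sum.mono_neutral_right) (use elim(2) in \<open>auto simp: gbinomial_0_left\<close>)
    also have "\<dots> = (\<Sum>s<N. (- h) ^ s *s P x (n + int s) w)"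
      by (simp add: bin1 x_def flip: power_mult_distrib)
    finally show ?case .
  qed
  obtain M where M: "\<And>r. r \<ge> M \<Longrightarrow> P x r w = 0" using P_truncation by blast
  from E[of n] E[of "n + 1"] eventually_ge_at_top[of "nat (M - n)"]
  show ?thesis
  proof eventually_elim
    case (elim N)
    define f where "f s = (- h) ^ s *s P x (n + int s) w" for s :: nat
    have tele: "(\<Sum>s<K. f s - f (Suc s)) = f 0 - f K" for K
      by (induction K) auto
    have "(\<Sum>i<N. of_nat (Suc i) *s (A n i + h *s A (n + 1) i))
       = (\<Sum>i<N. of_nat (Suc i) *s A n i) + h *s (\<Sum>i<N. of_nat (Suc i) *s A (n + 1) i)"
      by (simp only: degree.scale_right_distrib degree.scale_sum_right sum.distrib
          degree.scale_left_commute)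
    also have "\<dots> = (\<Sum>s<N. f s) + h *s (\<Sum>s<N. (- h) ^ s *s P x (n + 1 + int s) w)"
      using elim by (simp add: f_def)
    also have "h *s (\<Sum>s<N. (- h) ^ s *s P x (n + 1 + int s) w) = (\<Sum>s<N. - f (Suc s))"
      unfolding f_def degree.scale_sum_right
      by (intro sum.cong) (auto simp: algebra_simps)
    also have "(\<Sum>s<N. f s) + (\<Sum>s<N. - f (Suc s)) = f 0 - f N"
      using tele[of N] by (simp add: sum_subtractf sum_negf)
    also have "\<dots> = P (P u (-2) v) n w"
      using M[of "n + int N"] elim(3) by (simp add: f_def x_def)
    finally show ?case by simp
  qed
qed

text \<open>
  For \<open>v = 1\<close> a single term of the iterate formula survives for each of \<open>n\<close> and \<open>n + 1\<close>; with
  \<open>n = -2 - j\<close> it reads \<open>(u\<^bsub>-2\<^esub> 1)\<^sub>n w = (j + 2) u\<^bsub>-3-j\<^esub> w + h (j + 1) u\<^bsub>-2-j\<^esub> w\<close>. The left hand side has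
  index \<open>-2 - j\<close>, so the products of index at most \<open>-2\<close> lie in \<open>J\<close> by induction on \<open>j\<close>, for all \<open>u\<close>
  at once.
\<close>

lemma P_le_minus_two_in_J: "P u (-2 - int j) w \<in> J"
proof (induction j arbitrary: u)
  case 0
  then show ?case by (simp add: P_minus_two_in_J)
next
  case (Suc j)
  show ?case
  proof (induction u rule: degree.homogeneous_induct)
    case (homogeneous p u)
    define n where "n = -2 - int j"
    have delta: "(\<Sum>i<N. of_nat (Suc i) *s (P u (-2 - int i) (P vac (r + int i) w)
          - c *s P vac (r - 2 - int i) (P u (int i) w))) = of_nat (Suc K) *s P u (-2 - int K) w"
      if "r = -1 - int K" "N > K" for r K N c
    proof -
      have "(\<Sum>i<N. of_nat (Suc i) *s (P u (-2 - int i) (P vac (r + int i) w)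
          - c *s P vac (r - 2 - int i) (P u (int i) w)))
        = (\<Sum>i\<in>{K}. of_nat (Suc i) *s (P u (-2 - int i) (P vac (r + int i) w)
          - c *s P vac (r - 2 - int i) (P u (int i) w)))"
        by (rule sum.mono_neutral_right) (use that in \<open>auto simp: P_vacuum\<close>)
      then show ?thesis using that by (simp add: P_vacuum)
    qed
    have "\<forall>\<^sub>F N in sequentially. P (P u (-2) vac) n w
        = of_nat (Suc (Suc j)) *s P u (-2 - int (Suc j)) w + h *s of_nat (Suc j) *s P u (-2 - int j) w"
      using minus_two_iterate[OF homogeneous vac_in_deg, of n w] eventually_gt_at_top[of "Suc j"]
    proof eventually_elim
      case (elim N)
      note elim(1)
      also have "(\<Sum>i<N. of_nat (Suc i) *s (P u (-2 - int i) (P vac (n + int i) w)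
            - ((-1) powi (p * 0)) *s P vac (n - 2 - int i) (P u (int i) w) +
            h *s (P u (-2 - int i) (P vac (n + 1 + int i) w)
            - ((-1) powi (p * 0)) *s P vac (n + 1 - 2 - int i) (P u (int i) w))))
          = (\<Sum>i<N. of_nat (Suc i) *s (P u (-2 - int i) (P vac (n + int i) w)
            - ((-1) powi (p * 0)) *s P vac (n - 2 - int i) (P u (int i) w))) +
            h *s (\<Sum>i<N. of_nat (Suc i) *s (P u (-2 - int i) (P vac (n + 1 + int i) w)
            - ((-1) powi (p * 0)) *s P vac (n + 1 - 2 - int i) (P u (int i) w)))"
        by (simp only: degree.scale_right_distrib degree.scale_sum_right sum.distrib
          degree.scale_left_commute)
      also have "\<dots> = of_nat (Suc (Suc j)) *s P u (-2 - int (Suc j)) w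
          + h *s of_nat (Suc j) *s P u (-2 - int j) w"
        using elim(2) by (subst (1 2) delta[where K = "Suc j"] delta[where K = j])
          (auto simp: n_def delta[where K = "Suc j"] delta[where K = j])
      finally show ?case .
    qed
    then have "of_nat (Suc (Suc j)) *s P u (-2 - int (Suc j)) w
        = P (P u (-2) vac) n w - h *s of_nat (Suc j) *s P u (-2 - int j) w"
      by (simp add: eventually_const_iff del: of_nat_Suc)
    also have "\<dots> \<in> J"
      unfolding n_def by (intro J_diff J_scale Suc.IH)
    finally have "of_nat (Suc (Suc j)) *s P u (-2 - int (Suc j)) w \<in> J" .
    from J_scale[OF this, of "inverse (of_nat (Suc (Suc j)))"] show ?case
      by (simp del: of_nat_Suc)
  qed (simp add: P_add_left J_add)
qed

lemma P_in_J: "n \<le> -2 \<Longrightarrow> P u n w \<in> J"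
  using P_le_minus_two_in_J[of u "nat (-2 - n)" w] by simp

lemma commutator:
  assumes "u \<in> deg p" "v \<in> deg q"
  shows "\<forall>\<^sub>F N in sequentially.
    P u m (P v n w) - ((-1) powi (p * q)) *s P v n (P u m w) =
      (\<Sum>k<N. (of_int m gchoose k) *s (\<Sum>s<N. ((of_nat (Suc k) gchoose s) * h ^ s) *s
          P (P u (int k) v) (m + n - int k + int s) w))"
  using deformed_jacobi[OF assms, of 0 m n w] eventually_gt_at_top[of 0]
proof eventually_elim
  case (elim N)
  have "(\<Sum>i<N. ((-1) ^ i * (of_int 0 gchoose i)) *s
          (P u (m + 0 - int i) (P v (n + int i) w)
            - ((-1) powi 0 * (-1) powi (p * q)) *s P v (n + 0 - int i) (P u (m + int i) w)))
     = (\<Sum>i\<in>{0}. ((-1) ^ i * (of_int 0 gchoose i)) *s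
          (P u (m + 0 - int i) (P v (n + int i) w)
            - ((-1) powi 0 * (-1) powi (p * q)) *s P v (n + 0 - int i) (P u (m + int i) w)))"
    by (rule sum.mono_neutral_right) (use elim(2) in \<open>auto simp: gbinomial_0_left\<close>)
  with elim(1) show ?case by (simp add: add.commute)
qed

lemma gchoose_Suc_eq_0: "Suc k < s \<Longrightarrow> (of_nat (Suc k) gchoose s :: complex) = 0"
  by (simp flip: binomial_gbinomial del: of_nat_Suc)

text \<open>
  The commutator of \<open>u\<^bsub>-1\<^esub>\<close> and \<open>v\<^bsub>-2\<^esub>\<close> involves only products of index \<open>-3 - k + s\<close> with \<open>s \<le> k + 1\<close>,
  hence of index at most \<open>-2\<close>.
\<close>

lemma J_left_ideal:
  assumes "w \<in> J"
  shows "P u (-1) w \<in> J"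
  using assms
proof (induction w rule: J_induct)
  case (generator q r v w)
  note v = generator(1)
  show ?case
  proof (induction u rule: degree.homogeneous_induct)
    case (homogeneous p u)
    have "\<forall>\<^sub>F N in sequentially.
      P u (-1) (P v (-2) w) - ((-1) powi (p * q)) *s P v (-2) (P u (-1) w) \<in> J"
      using commutator[OF homogeneous v, of "-1" "-2" w]
    proof eventually_elim
      case (elim N)
      have *: "((of_nat (Suc k) gchoose s) * h ^ s) *s P (P u (int k) v) (- 3 - int k + int s) w \<in> J"
        for k s
        by (cases "s \<le> Suc k") (auto simp: gchoose_Suc_eq_0 J_zero simp del: of_nat_Suc intro!: J_scale P_in_J)
      show ?case unfolding elim
        by (intro J_sum J_scale[OF J_sum]) (use * in \<open>simp\<close>)
    qed
    then have "P u (-1) (P v (-2) w) - ((-1) powi (p * q)) *s P v (-2) (P u (-1) w) \<in> J"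
      by (simp add: eventually_const_iff)
    from J_add[OF this J_scale[OF P_minus_two_in_J[of v "P u (-1) w"], of "(-1) powi (p * q)"]]
    show ?case by simp
  qed (simp add: P_add_left J_add)
qed (auto simp: P_add_right P_scale_right J_add J_scale)

text \<open>
  In the iterate formula for \<open>(u\<^bsub>-2\<^esub> v)\<^bsub>-1\<^esub> w\<close> all outer products have index at most \<open>-2\<close>.
\<close>

lemma J_right_ideal:
  assumes "x \<in> J"
  shows "P x (-1) w \<in> J"
  using assms
proof (induction x rule: J_induct)
  case (generator p q u v)
  from minus_two_iterate[OF this, of "-1" w]
  have "\<forall>\<^sub>F N in sequentially. P (P u (-2) v) (-1) w \<in> J"
  proof eventually_elim
    case (elim N)
    show ?case unfolding elim
      by (intro J_sum J_scale J_add J_diff P_in_J) auto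
  qed
  then show ?case by (simp add: eventually_const_iff)
qed (auto simp: P_add_left P_scale_left J_add J_scale)

text \<open>
  In the Jacobi identity for \<open>l = n = -1\<close>, \<open>m = 0\<close> the exponent \<open>l + k + 1\<close> vanishes at the only
  relevant \<open>k = 0\<close>, so the right hand side is undeformed. On the left only \<open>u\<^bsub>-1\<^esub> (v\<^bsub>-1\<^esub> w)\<close> has an outer
  index above \<open>-2\<close>.
\<close>

lemma P_minus_one_assoc_mod_J: "P (P u (-1) v) (-1) w - P u (-1) (P v (-1) w) \<in> J"
proof (induction u rule: degree.homogeneous_induct)
  case (homogeneous p u)
  show ?case
  proof (induction v rule: degree.homogeneous_induct)
    case (homogeneous q v)
    note u = \<open>u \<in> deg p\<close> and v = homogeneous
    have bin1: "(-1) ^ s * ((-1::complex) gchoose s) = 1" for s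
      using gbinomial_minus[of "1::complex" s] binomial_gbinomial[of s s, where 'a = complex]
      by (simp flip: power_add mult_2)
    have "\<forall>\<^sub>F N in sequentially. P (P u (-1) v) (-1) w - P u (-1) (P v (-1) w) \<in> J"
      using deformed_jacobi[OF u v, of "-1" 0 "-1" w] eventually_gt_at_top[of 0]
    proof eventually_elim
      case (elim N)
      define f where "f i = P u (-1 - int i) (P v (-1 + int i) w)
        + ((-1) powi (p * q)) *s P v (-2 - int i) (P u (int i) w)" for i
      have rhs0: "(\<Sum>s<N. ((0 gchoose s) * h ^ s) *s P (P u (-1) v) (-1 + int s) w)
          = (\<Sum>s\<in>{0}. ((0 gchoose s) * h ^ s) *s P (P u (-1) v) (-1 + int s) w)"
        by (rule sum.mono_neutral_right) (use elim(2) in \<open>auto simp: gbinomial_0_left\<close>)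
      have "(\<Sum>k<N. (of_int 0 gchoose k) *s (\<Sum>s<N. ((of_int (- 1 + int k + 1) gchoose s) * h ^ s) *s
            P (P u (- 1 + int k) v) (0 + - 1 - int k + int s) w))
        = (\<Sum>k\<in>{0}. (of_int 0 gchoose k) *s (\<Sum>s<N. ((of_int (- 1 + int k + 1) gchoose s) * h ^ s) *s
            P (P u (- 1 + int k) v) (0 + - 1 - int k + int s) w))"
        by (rule sum.mono_neutral_right) (use elim(2) in \<open>auto simp: gbinomial_0_left\<close>)
      with elim(1) have "sum f {..<N} = P (P u (-1) v) (-1) w"
        using rhs0 by (simp add: bin1 f_def)
      moreover obtain N' where "N = Suc N'" using elim(2) gr0_implies_Suc by blast
      ultimately have "P (P u (-1) v) (-1) w - P u (-1) (P v (-1) w)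
          = ((-1) powi (p * q)) *s P v (-2) (P u 0 w) + (\<Sum>i<N'. f (Suc i))"
        by (simp add: sum.lessThan_Suc_shift f_def algebra_simps del: sum.lessThan_Suc)
      also have "\<dots> \<in> J"
        unfolding f_def by (intro J_sum J_add J_scale P_in_J) auto
      finally show ?case .
    qed
    then show ?case by (simp add: eventually_const_iff)
  next
    case (add v v')
    from J_add[OF this] show ?case by (simp add: P_add_left P_add_right algebra_simps)
  qed
next
  case (add u u')
  from J_add[OF this] show ?case by (simp add: P_add_left algebra_simps)
qed

text \<open>
  Apply the commutator of \<open>u\<^bsub>-1\<^esub>\<close> and \<open>v\<^bsub>-1\<^esub>\<close> to the vacuum. A product \<open>x\<^sub>r 1\<close> vanishes for \<open>r \<ge> 0\<close>, is
  \<open>x\<close> for \<open>r = -1\<close> and lies in \<open>J\<close> below that, so modulo \<open>J\<close> each \<open>k\<close> contributes a multiple of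
  \<open>u\<^sub>k v\<close>, and \<open>k = 0\<close> contributes \<open>h u\<^sub>0 v\<close>. The subspace \<open>S\<close> is a parameter because positive indices
  will be negligible for degree reasons.
\<close>

lemma supercommutator_mod_J:
  assumes "u \<in> deg p" "v \<in> deg q"
    and S: "degree.subspace S" "J \<subseteq> S" "\<And>k. k > 0 \<Longrightarrow> P u k v \<in> S"
  shows "P u (-1) v - ((-1) powi (p * q)) *s P v (-1) u - h *s P u 0 v \<in> S"
proof -
  note S_intros = degree.subspace_add[OF S(1)] degree.subspace_scale[OF S(1)]
    degree.subspace_sum[OF S(1)] degree.subspace_0[OF S(1)] subsetD[OF S(2)]
  have "\<forall>\<^sub>F N in sequentially.
    P u (-1) v - ((-1) powi (p * q)) *s P v (-1) u - h *s P u 0 v \<in> S"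
    using commutator[OF assms(1,2), of "-1" "-1" vac] eventually_gt_at_top[of 2]
  proof eventually_elim
    case (elim N)
    define f where "f k = (of_int (-1) gchoose k) *s (\<Sum>s<N. ((of_nat (Suc k) gchoose s) * h ^ s) *s
          P (P u (int k) v) (-1 + -1 - int k + int s) vac)" for k
    obtain N' where N': "N = Suc (Suc (Suc N'))"
      using elim(2) by (metis Suc_lessE numeral_2_eq_2 gr0_implies_Suc lessE)
    have "f 0 = P (P u 0 v) (-2) vac + h *s P u 0 v"
    proof -
      have "(\<Sum>s<N. ((of_nat (Suc 0) gchoose s) * h ^ s) *s P (P u (int 0) v) (-1 + -1 - int 0 + int s) vac)
        = (\<Sum>s\<in>{0,1}. ((of_nat (Suc 0) gchoose s) * h ^ s) *s P (P u (int 0) v) (-1 + -1 - int 0 + int s) vac)"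
        by (rule sum.mono_neutral_right) (use elim(2) in \<open>auto simp: P_creation_regular\<close>)
      then show ?thesis by (simp add: f_def P_creation_constant)
    qed
    moreover have "f k \<in> S" if "k > 0" for k
    proof -
      have "P (P u (int k) v) (-1 + -1 - int k + int s) vac \<in> S" for s
      proof -
        consider "s < Suc k" | "s = Suc k" | "s > Suc k" by linarith
        then show ?thesis
        proof cases
          case 1
          then show ?thesis by (intro S_intros P_in_J) auto
        qed (use that in \<open>auto simp: P_creation_regular P_creation_constant intro: S_intros S(3)\<close>)
      qed
      then show ?thesis
        unfolding f_def
        by (intro degree.subspace_scale[OF S(1)] degree.subspace_sum[OF S(1)])
    qed
    moreover have "P u (-1) v - ((-1) powi (p * q)) *s P v (-1) u = f 0 + (\<Sum>k<Suc (Suc N'). f (Suc k))"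
    proof -
      have "P u (-1) v - ((-1) powi (p * q)) *s P v (-1) u = sum f {..<N}"
        using elim(1) unfolding f_def by (simp add: P_creation_constant)
      then show ?thesis unfolding N' by (simp only: sum.lessThan_Suc_shift)
    qed
    ultimately have "P u (-1) v - ((-1) powi (p * q)) *s P v (-1) u - h *s P u 0 v
       = P (P u 0 v) (-2) vac + (\<Sum>k<Suc (Suc N'). f (Suc k))" by simp
    also have "\<dots> \<in> S"
      using \<open>\<And>k. k > 0 \<Longrightarrow> f k \<in> S\<close>
      by (intro degree.subspace_add[OF S(1)] degree.subspace_sum[OF S(1)])
        (auto intro: subsetD[OF S(2)] P_minus_two_in_J)
    finally show ?case .
  qed
  then show ?thesis by (simp add: eventually_const_iff)
qed

end

section \<open>Modes of a dg vertex algebra\<close>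

lemma Sum_any_eq_sum_lessThan:
  fixes f :: "nat \<Rightarrow> 'a::comm_monoid_add"
  assumes "\<And>i. i \<ge> M \<Longrightarrow> f i = 0" "M \<le> N"
  shows "Sum_any f = (\<Sum>i<N. f i)"
proof (rule Sum_any.expand_superset)
  show "{a. f a \<noteq> 0} \<subseteq> {..<N}" using assms by (auto simp: not_le[symmetric])
qed simp

context dg_vertex_algebra
begin

text \<open>
  The bounds on the summation indices that truncation provides do not grow when \<open>m\<close> and \<open>n\<close> are
  raised, so one bound serves for all larger indices. This is needed because the expansion of \<open>(1 + x)\<^bsup>wt u\<^esup>\<close> and \<open>(1 + x)\<^bsup>wt v\<^esup>\<close> shifts \<open>m\<close> and \<open>n\<close> upwards by arbitrary amounts.
\<close>

lemma jacobi_uniform: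
  assumes "u \<in> deg p" "v \<in> deg q"
  shows "\<exists>M. \<forall>N\<ge>M. \<forall>m\<ge>m0. \<forall>n\<ge>n0.
    (\<Sum>i<N. ((-1) ^ i * (of_int l gchoose i)) *s
        (Y u (m + l - int i) (Y v (n + int i) w)
          - ((-1) powi l * (-1) powi (p * q)) *s Y v (n + l - int i) (Y u (m + int i) w)))
    = (\<Sum>k<N. (of_int m gchoose k) *s Y (Y u (l + int k) v) (m + n - int k) w)"
proof -
  interpret YR: Vector_Spaces.linear scale scale "Y x r" for x r by (rule Y_linear_right)
  interpret YL: Vector_Spaces.linear scale scale "\<lambda>x. Y x r y" for r y by (rule Y_linear_left)
  obtain N1 where N1: "\<And>n. n \<ge> N1 \<Longrightarrow> Y v n w = 0" using truncation by blast
  obtain N2 where N2: "\<And>n. n \<ge> N2 \<Longrightarrow> Y u n w = 0" using truncation by blast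
  obtain N3 where N3: "\<And>n. n \<ge> N3 \<Longrightarrow> Y u n v = 0" using truncation by blast
  define M where "M = nat (max (N1 - n0) (max (N2 - m0) (N3 - l)))"
  show ?thesis
  proof (intro exI[of _ M] allI impI)
    fix N m n assume le: "M \<le> N" "m0 \<le> m" "n0 \<le> n"
    show "(\<Sum>i<N. ((-1) ^ i * (of_int l gchoose i)) *s
        (Y u (m + l - int i) (Y v (n + int i) w)
          - ((-1) powi l * (-1) powi (p * q)) *s Y v (n + l - int i) (Y u (m + int i) w)))
      = (\<Sum>k<N. (of_int m gchoose k) *s Y (Y u (l + int k) v) (m + n - int k) w)"
    proof -
      have "Y v (n + int i) w = 0" "Y u (m + int i) w = 0" "Y u (l + int i) v = 0" if "M \<le> i" for i
        using that le N1[of "n + int i"] N2[of "m + int i"] N3[of "l + int i"]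
        by (auto simp: M_def)
      then show ?thesis
        using jacobi[OF assms, of l m n w] le(1)
        by (subst (asm) (1 2) Sum_any_eq_sum_lessThan[where M = M and N = N])
          (auto simp: YR.zero YL.zero)
    qed
  qed
qed

sublocale degree: graded_vector_space scale deg
  by unfold_locales (auto simp: deg_subspace deg_direct_sum)

sublocale undeformed: deformed_vertex_algebra scale deg 0 Y vac
proof unfold_locales
  fix u v w :: 'v and p q l m n :: int
  interpret YR: Vector_Spaces.linear scale scale "Y x r" for x r by (rule Y_linear_right)
  interpret YL: Vector_Spaces.linear scale scale "\<lambda>x. Y x r y" for r y by (rule Y_linear_left)
  { fix u v w n c show "Y (u + v) n w = Y u n w + Y v n w" "Y (c *s u) n w = c *s Y u n w"
    "Y u n (v + w) = Y u n v + Y u n w" "Y u n (c *s v) = c *s Y u n v"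
    by (auto simp: YL.add YL.scale YR.add YR.scale) }
  assume uv: "u \<in> deg p" "v \<in> deg q"
  obtain M where M: "\<And>N. N \<ge> M \<Longrightarrow>
    (\<Sum>i<N. ((-1) ^ i * (of_int l gchoose i)) *s
        (Y u (m + l - int i) (Y v (n + int i) w)
          - ((-1) powi l * (-1) powi (p * q)) *s Y v (n + l - int i) (Y u (m + int i) w)))
    = (\<Sum>k<N. (of_int m gchoose k) *s Y (Y u (l + int k) v) (m + n - int k) w)"
    using jacobi_uniform[OF uv, of m n l w] by blast
  show "\<forall>\<^sub>F N in sequentially.
        (\<Sum>i<N. ((-1) ^ i * (of_int l gchoose i)) *s
          (Y u (m + l - int i) (Y v (n + int i) w)
            - ((-1) powi l * (-1) powi (p * q)) *s Y v (n + l - int i) (Y u (m + int i) w)))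
        = (\<Sum>k<N. (of_int m gchoose k) *s (\<Sum>s<N. ((of_int (l + int k + 1) gchoose s) * 0 ^ s) *s
            Y (Y u (l + int k) v) (m + n - int k + int s) w))"
    using eventually_gt_at_top[of 0] eventually_ge_at_top[of M]
  proof eventually_elim
    case (elim N)
    have "(\<Sum>s<N. ((of_int (l + int k + 1) gchoose s) * 0 ^ s) *s
              Y (Y u (l + int k) v) (m + n - int k + int s) w)
        = (\<Sum>s\<in>{0}. ((of_int (l + int k + 1) gchoose s) * 0 ^ s) *s
              Y (Y u (l + int k) v) (m + n - int k + int s) w)" for k
      by (rule sum.mono_neutral_right) (use elim(1) in auto)
    then show ?case using M[OF elim(2)] by simp
  qed
qed (simp_all add: Y_linear_left Y_linear_right truncation vac_degree vacuum creation_constant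
      creation_regular)

lemma C2_eq: "C2 = undeformed.J"
  by (simp add: C2_def undeformed.J_def)

lemma commutator_modes:
  assumes "u \<in> deg p" "v \<in> deg q"
  shows "\<forall>\<^sub>F N in sequentially.
    Y u m (Y v n w) - ((-1) powi (p * q)) *s Y v n (Y u m w) =
      (\<Sum>k<N. (of_int m gchoose k) *s Y (Y u (int k) v) (m + n - int k) w)"
  using undeformed.commutator[OF assms, of m n w] eventually_gt_at_top[of 0]
proof eventually_elim
  case (elim N)
  have "(\<Sum>s<N. ((of_nat (Suc k) gchoose s) * 0 ^ s) *s
          Y (Y u (int k) v) (m + n - int k + int s) w)
      = (\<Sum>s\<in>{0}. ((of_nat (Suc k) gchoose s) * 0 ^ s) *s
          Y (Y u (int k) v) (m + n - int k + int s) w)" for k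
    by (rule sum.mono_neutral_right) (use elim(2) in auto)
  then show ?case using elim(1) by simp
qed

text \<open>The mode \<open>u\<^sub>0\<close> is a derivation of every product.\<close>

lemma zero_mode_commutator:
  assumes "u \<in> deg p" "v \<in> deg q"
  shows "Y u 0 (Y v n w) = Y (Y u 0 v) n w + ((-1) powi (p * q)) *s Y v n (Y u 0 w)"
proof -
  have "\<forall>\<^sub>F N in sequentially.
    Y u 0 (Y v n w) - ((-1) powi (p * q)) *s Y v n (Y u 0 w) = Y (Y u 0 v) n w"
    using commutator_modes[OF assms, of 0 n w] eventually_gt_at_top[of 0]
  proof eventually_elim
    case (elim N)
    have "(\<Sum>k<N. (of_int 0 gchoose k) *s Y (Y u (int k) v) (0 + n - int k) w)
      = (\<Sum>k\<in>{0}. (of_int 0 gchoose k) *s Y (Y u (int k) v) (0 + n - int k) w)"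
      by (rule sum.mono_neutral_right) (use elim(2) in \<open>auto simp: gbinomial_0_left\<close>)
    then show ?case using elim(1) by simp
  qed
  then show ?thesis by (simp add: eventually_const_iff algebra_simps)
qed

lemma zero_mode_C2_right:
  assumes "w \<in> C2"
  shows "Y u 0 w \<in> C2"
  using assms unfolding C2_eq
proof (induction w rule: undeformed.J_induct)
  case (generator q r v w)
  show ?case
  proof (induction u rule: degree.homogeneous_induct)
    case (homogeneous p u)
    show ?case
      unfolding zero_mode_commutator[OF homogeneous generator(1)]
      by (intro undeformed.J_add undeformed.J_scale undeformed.P_minus_two_in_J)
  qed (simp add: undeformed.P_add_left undeformed.J_add)
qed (auto simp: undeformed.P_add_right undeformed.P_scale_right undeformed.J_add undeformed.J_scale)

text \<open>
  The iterate formula for \<open>(u\<^bsub>-2\<^esub> v)\<^sub>0 w\<close> has outer products of index \<open>-1\<close> only in the terms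
  multiplied by \<open>h\<close>, and here \<open>h = 0\<close>.
\<close>

lemma zero_mode_C2_left:
  assumes "x \<in> C2"
  shows "Y x 0 w \<in> C2"
  using assms unfolding C2_eq
proof (induction x rule: undeformed.J_induct)
  case (generator p q u v)
  from undeformed.minus_two_iterate[OF this, of 0 w]
  have "\<forall>\<^sub>F N in sequentially. Y (Y u (-2) v) 0 w \<in> undeformed.J"
  proof eventually_elim
    case (elim N)
    show ?case unfolding elim scale_zero_left add_0_right
      by (intro undeformed.J_sum undeformed.J_scale undeformed.J_add undeformed.J_diff
          undeformed.P_in_J) auto
  qed
  then show ?case by (simp add: eventually_const_iff)
qed (auto simp: undeformed.P_add_left undeformed.P_scale_left undeformed.J_add undeformed.J_scale)

text \<open>
  This is the commutator of \<open>u\<^bsub>-1\<^esub>\<close> and \<open>v\<^sub>0\<close> applied to the vacuum.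
\<close>

lemma zero_mode_skew_mod_C2:
  assumes "u \<in> deg p" "v \<in> deg q"
  shows "Y u 0 v + ((-1) powi (p * q)) *s Y v 0 u \<in> C2"
proof -
  have "\<forall>\<^sub>F N in sequentially. Y u 0 v + ((-1) powi (p * q)) *s Y v 0 u \<in> C2"
    using commutator_modes[OF assms, of "-1" 0 vac] eventually_gt_at_top[of 0]
  proof eventually_elim
    case (elim N)
    then obtain N' where N': "N = Suc N'" using gr0_implies_Suc by blast
    define f where "f k = (of_int (- 1) gchoose k) *s Y (Y u (int k) v) (- 1 + 0 - int k) vac" for k
    have "- (((-1) powi (p * q)) *s Y v 0 u) = sum f {..<N}"
      using elim(1) unfolding f_def by (simp add: creation_constant creation_regular undeformed.P_zero_right)
    also have "\<dots> = Y u 0 v + (\<Sum>k<N'. f (Suc k))"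
      by (simp add: N' sum.lessThan_Suc_shift f_def creation_constant del: sum.lessThan_Suc)
    finally have "Y u 0 v + ((-1) powi (p * q)) *s Y v 0 u = - (\<Sum>k<N'. f (Suc k))"
      by (auto simp: neg_eq_iff_add_eq_0 eq_neg_iff_add_eq_0 add_ac)
    also have "\<dots> \<in> C2"
      unfolding C2_eq f_def
      by (intro subspace_neg[OF undeformed.subspace_J] undeformed.J_sum undeformed.J_scale
          undeformed.P_in_J) auto
    finally show ?case .
  qed
  then show ?thesis by (simp add: eventually_const_iff)
qed

lemma d_add: "d (u + v) = d u + d v"
  and d_scale: "d (c *s u) = c *s d u"
  and d_sum: "d (sum f A) = (\<Sum>a\<in>A. d (f a))"
proof -
  interpret D: Vector_Spaces.linear scale scale d by (rule d_linear)
  show "d (u + v) = d u + d v" "d (c *s u) = c *s d u" "d (sum f A) = (\<Sum>a\<in>A. d (f a))"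
    by (auto simp: D.add D.scale D.sum)
qed

lemma d_Y:
  assumes "u \<in> deg p"
  shows "d (Y u n w) = Y (d u) n w + ((-1) powi p) *s Y u n (d w)"
  using Y_d[OF assms] by (simp add: algebra_simps)

lemma d_C2:
  assumes "x \<in> C2"
  shows "d x \<in> C2"
  using assms unfolding C2_eq
proof (induction x rule: undeformed.J_induct)
  case (generator p q u v)
  show ?case unfolding d_Y[OF generator(1)]
    by (intro undeformed.J_add undeformed.J_scale undeformed.P_minus_two_in_J)
qed (auto simp: d_add d_scale undeformed.J_add undeformed.J_scale)

lemma component_C2:
  assumes "x \<in> C2"
  shows "component deg x r \<in> C2"
  using assms unfolding C2_eq
proof (induction x rule: undeformed.J_induct)
  case (generator p q u v)
  show ?case
    using degree.component_homogeneous[OF Y_degree[OF generator, of "-2"], of r]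
    by (auto simp: undeformed.J_zero undeformed.P_minus_two_in_J)
qed (auto simp: degree.component_add degree.component_scale undeformed.J_add undeformed.J_scale)

end

section \<open>Quotients on which the modes induce a dg Poisson structure\<close>

text \<open>
  Stated for a surjection \<open>\<pi>\<close> instead of a quotient space, so that it covers the cosets of \<open>R(V)\<close> as
  well as the families of iterated cosets that make up \<open>gr A(V)\<close>. The last assumption says that the
  kernel is graded, which makes the sum of the homogeneous parts of the target direct.
\<close>

locale poisson_quotient = dg_vertex_algebra scale deg d Y vac
  for scale :: "complex \<Rightarrow> 'v::ab_group_add \<Rightarrow> 'v" (infixr \<open>*s\<close> 75)
    and deg d Y vac +
  fixes Q :: "('b, 'm) dg_poisson_scheme" (structure)
    and \<pi> :: "'v \<Rightarrow> 'b"
  assumes carrier_eq: "carrier Q = range \<pi>"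
    and pi_add: "\<pi> u \<oplus> \<pi> v = \<pi> (u + v)"
    and pi_mult: "\<pi> u \<otimes> \<pi> v = \<pi> (Y u (-1) v)"
    and pi_one: "\<one> = \<pi> vac"
    and pi_zero: "\<zero> = \<pi> 0"
    and pi_smult: "c \<odot> \<pi> u = \<pi> (c *s u)"
    and pi_hpart: "hpart Q p = \<pi> ` deg p"
    and pi_diff: "dgdiff Q (\<pi> u) = \<pi> (d u)"
    and pi_bracket: "pbracket Q (\<pi> u) (\<pi> v) = \<pi> (Y u 0 v)"
    and pi_C2: "u \<in> C2 \<Longrightarrow> \<pi> u = \<zero>"
    and pi_graded: "\<pi> u = \<zero> \<Longrightarrow> \<pi> (component deg u p) = \<zero>"
begin

lemma pi_eqI: "u - v \<in> C2 \<Longrightarrow> \<pi> u = \<pi> v"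
  using pi_add[of "u - v" v] pi_add[of 0 v] pi_C2[of "u - v"] pi_zero by simp

lemma pi_eqD: "\<pi> u = \<pi> v \<Longrightarrow> \<pi> (u - v) = \<zero>"
  using pi_add[of u "-v"] pi_add[of v "-v"] pi_zero by simp

sublocale abelian_group Q
proof (rule abelian_groupI)
  fix x assume "x \<in> carrier Q"
  then obtain u where u: "x = \<pi> u" by (auto simp: carrier_eq)
  show "\<exists>y\<in>carrier Q. y \<oplus> x = \<zero>"
    by (rule bexI[of _ "\<pi> (- u)"]) (auto simp: u pi_add pi_zero carrier_eq)
qed (auto simp: carrier_eq pi_add pi_zero add_ac)

lemma pi_minus: "\<ominus> \<pi> u = \<pi> (- u)"
  by (rule minus_equality) (auto simp: pi_add pi_zero carrier_eq)

lemma pi_sum: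
  assumes "finite A" "\<And>i. i \<in> A \<Longrightarrow> f i = \<pi> (g i)"
  shows "finsum Q f A = \<pi> (sum g A)"
  using assms by (induction A) (auto simp: pi_zero carrier_eq pi_add)

text \<open>
  Uniqueness of the homogeneous decomposition in the target: the difference of two decompositions
  lifts to a vector in the kernel, and so do its components.
\<close>

lemma finsum_eq_component:
  assumes f: "\<And>p. f p \<in> hpart Q p" and fin: "finite {p. f p \<noteq> \<zero>}"
    and x: "\<pi> u = finsum Q f {p. f p \<noteq> \<zero>}"
  shows "f p = \<pi> (component deg u p)"
proof -
  have "\<exists>g. g \<in> deg p \<and> f p = \<pi> g \<and> (f p = \<zero> \<longrightarrow> g = 0)" for p
  proof (cases "f p = \<zero>")
    case True
    then show ?thesis using pi_zero subspace_0[OF deg_subspace] by auto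
  next
    case False
    then show ?thesis using f[of p] by (auto simp: pi_hpart)
  qed
  then obtain g where g: "\<And>p. g p \<in> deg p" "\<And>p. f p = \<pi> (g p)" "\<And>p. f p = \<zero> \<Longrightarrow> g p = 0"
    by metis
  define A where "A = {p. f p \<noteq> \<zero>}"
  have "component deg (sum g A) = g"
    by (rule degree.component_superset_eqI[where A = A]) (use fin g in \<open>auto simp: A_def\<close>)
  moreover have "\<pi> u = \<pi> (sum g A)"
    unfolding x A_def by (rule pi_sum) (use fin g in auto)
  ultimately have "\<pi> (component deg u p - g p) = \<zero>"
    using pi_graded[OF pi_eqD, of u "sum g A" p] by (simp add: degree.component_diff)
  then have "\<pi> (component deg u p) = \<pi> (g p)"
    using pi_add[of "component deg u p - g p" "g p"] pi_add[of 0 "g p"] pi_zero by simp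
  then show ?thesis using g by simp
qed

lemma component_finsum:
  fixes u :: 'v
  defines "f \<equiv> \<lambda>p. \<pi> (component deg u p)"
  shows "finite {p. f p \<noteq> \<zero>}" "\<pi> u = finsum Q f {p. f p \<noteq> \<zero>}"
proof -
  let ?A = "{p. component deg u p \<noteq> 0}" and ?B = "{p. f p \<noteq> \<zero>}"
  have sub: "?B \<subseteq> ?A" by (auto simp: f_def pi_zero)
  then show fin: "finite ?B" using degree.finite_component finite_subset by blast
  have "\<pi> (sum (component deg u) (?A - ?B)) = finsum Q f (?A - ?B)"
    by (rule pi_sum[symmetric]) (auto simp: degree.finite_component f_def)
  also have "\<dots> = \<zero>"
    by (rule add.finprod_one_eqI) (auto)
  finally have 0: "\<pi> (sum (component deg u) (?A - ?B)) = \<pi> 0" by (simp add: pi_zero)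
  have "u = sum (component deg u) (?A - ?B) + sum (component deg u) ?B"
    using degree.sum_component[of u] sum.subset_diff[OF sub degree.finite_component]
    by metis
  then have "\<pi> u = \<pi> 0 \<oplus> \<pi> (sum (component deg u) ?B)"
    by (metis 0 pi_add)
  also have "\<dots> = finsum Q f ?B"
    using pi_sum[OF fin, of f "component deg u"] by (simp add: pi_add f_def)
  finally show "\<pi> u = finsum Q f ?B" .
qed

lemma scalar_ring:
  "carrier (ring_of_type_algebra :: complex ring) = UNIV"
  "a \<oplus>\<^bsub>ring_of_type_algebra\<^esub> b = (a + b :: complex)"
  "a \<otimes>\<^bsub>ring_of_type_algebra\<^esub> b = (a * b :: complex)"
  "\<one>\<^bsub>ring_of_type_algebra\<^esub> = (1 :: complex)"
  by (simp_all add: ring_of_type_algebra_def)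

lemma module_Q: "Module.module (ring_of_type_algebra :: complex ring) Q"
  by (rule moduleI)
    (auto simp: cring_from_type_algebra abelian_group_axioms scalar_ring carrier_eq pi_smult pi_add
      scale_left_distrib scale_right_distrib)

lemma ring_Q: "ring Q"
proof (rule ringI)
  show "monoid Q"
  proof (rule monoidI)
    fix x y z assume "x \<in> carrier Q" "y \<in> carrier Q" "z \<in> carrier Q"
    then obtain u v w where "x = \<pi> u" "y = \<pi> v" "z = \<pi> w" by (auto simp: carrier_eq)
    then show "x \<otimes> y \<otimes> z = x \<otimes> (y \<otimes> z)"
      using undeformed.P_minus_one_assoc_mod_J[of u v w] by (auto simp: pi_mult C2_eq intro: pi_eqI)
  qed (auto simp: carrier_eq pi_mult pi_one vacuum creation_constant)
qed (auto simp: carrier_eq pi_mult pi_add undeformed.P_add_left undeformed.P_add_right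
    abelian_group_axioms)

lemma dg_poisson_algebra: "dg_poisson_algebra (-2) Q"
proof (intro dg_poisson_algebra.intro module_Q ring_Q dg_poisson_algebra_axioms.intro, goal_cases)
  case (4 p)
  show ?case
  proof (rule module.submoduleI[OF module_Q])
    fix x assume "x \<in> hpart Q p"
    then show "\<ominus> x \<in> hpart Q p"
      using subspace_neg[OF deg_subspace] by (auto simp: pi_hpart pi_minus)
  qed (auto simp: pi_hpart carrier_eq pi_zero pi_add pi_smult
      intro!: imageI subspace_0 subspace_add subspace_scale deg_subspace)
next
  case (5 x)
  then obtain u where u: "x = \<pi> u" by (auto simp: carrier_eq)
  show ?case
  proof (rule ex1I[of _ "\<lambda>p. \<pi> (component deg u p)"])
    show "(\<forall>p. \<pi> (component deg u p) \<in> hpart Q p) \<and> finite {p. \<pi> (component deg u p) \<noteq> \<zero>} \<and>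
      x = finsum Q (\<lambda>p. \<pi> (component deg u p)) {p. \<pi> (component deg u p) \<noteq> \<zero>}"
      using component_finsum[of u] by (auto simp: u pi_hpart degree.component_in)
  next
    fix f assume "(\<forall>p. f p \<in> hpart Q p) \<and> finite {p. f p \<noteq> \<zero>} \<and> x = finsum Q f {p. f p \<noteq> \<zero>}"
    then show "f = (\<lambda>p. \<pi> (component deg u p))"
      using finsum_eq_component[of f u] by (auto simp: u)
  qed
next
  case (6 x p y q)
  then obtain u v where uv: "u \<in> deg p" "x = \<pi> u" "v \<in> deg q" "y = \<pi> v" by (auto simp: pi_hpart)
  have "Y u (-1) v \<in> deg (p + q)" using Y_degree[OF uv(1,3), of "-1"] by (simp add: add.commute)
  then show ?case by (auto simp: uv pi_hpart pi_mult)
next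
  case (18 x p y q)
  then obtain u v where uv: "u \<in> deg p" "x = \<pi> u" "v \<in> deg q" "y = \<pi> v" by (auto simp: pi_hpart)
  have "Y u 0 v \<in> deg (p + q + - 2)" using Y_degree[OF uv(1,3), of 0] by (simp add: algebra_simps)
  then show ?case by (auto simp: uv pi_hpart pi_bracket)
next
  case (19 x p y q)
  then obtain u v where uv: "u \<in> deg p" "x = \<pi> u" "v \<in> deg q" "y = \<pi> v" by (auto simp: pi_hpart)
  show ?case
    using zero_mode_skew_mod_C2[OF uv(1,3)]
    by (auto simp: uv pi_bracket pi_smult pi_minus intro: pi_eqI)
next
  case (20 x p y q z r)
  then obtain u v w where uvw: "u \<in> deg p" "x = \<pi> u" "v \<in> deg q" "y = \<pi> v" "z = \<pi> w"
    by (auto simp: pi_hpart)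
  show ?case
    using zero_mode_commutator[OF uvw(1,3), of 0 w] by (simp add: uvw pi_bracket pi_smult pi_add)
next
  case (21 x p y q z r)
  then obtain u v w where uvw: "u \<in> deg p" "x = \<pi> u" "v \<in> deg q" "y = \<pi> v" "z = \<pi> w"
    by (auto simp: pi_hpart)
  show ?case
    using zero_mode_commutator[OF uvw(1,3), of "-1" w]
    by (simp add: uvw pi_bracket pi_mult pi_smult pi_add)
qed (auto simp: carrier_eq pi_hpart pi_add pi_mult pi_smult pi_diff pi_bracket pi_zero
      undeformed.P_add_left undeformed.P_add_right undeformed.P_scale_left undeformed.P_scale_right
      d_add d_scale d_d d_Y intro!: imageI d_degree)

end

section \<open>Binomial identities\<close>

lemma sum_square_eq_triangle:
  fixes F :: "nat \<Rightarrow> nat \<Rightarrow> 'a::comm_monoid_add"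
  assumes "\<And>i j. i + j \<ge> N \<Longrightarrow> F i j = 0"
  shows "(\<Sum>i<N. \<Sum>j<N. F i j) = (\<Sum>e<N. \<Sum>i\<le>e. F i (e - i))"
proof -
  have "(\<Sum>i<N. \<Sum>j<N. F i j) = (\<Sum>(i, j)\<in>{..<N} \<times> {..<N}. F i j)"
    by (rule sum.cartesian_product)
  also have "\<dots> = (\<Sum>(i, j)\<in>{(i, j). i + j < N}. F i j)"
  proof (rule sum.mono_neutral_right)
    show "\<forall>x\<in>{..<N} \<times> {..<N} - {(i, j). i + j < N}. (case x of (i, j) \<Rightarrow> F i j) = 0"
      using assms by (auto simp: not_less) (meson not_less)
  qed auto
  also have "\<dots> = (\<Sum>e<N. \<Sum>i\<le>e. F i (e - i))"
    by (rule sum.triangle_reindex)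
  finally show ?thesis .
qed

lemma gbinomial_Vandermonde_atMost:
  fixes a b :: "'a::field_char_0"
  shows "(\<Sum>k\<le>n. (a gchoose k) * (b gchoose (n - k))) = (a + b) gchoose n"
  using gbinomial_Vandermonde[of a b n] by (simp add: atMost_atLeast0)

text \<open>
  Both sides are the coefficient of \<open>y\<^sup>K w\<^bsup>m-K+E\<^esup>\<close> in the formal expansion of
  \<open>(w + y)\<^sup>m (1 + w + y)\<^sup>\<alpha> (1 + w)\<^sup>\<beta>\<close> in nonnegative powers of \<open>y\<close>: the left one expands
  \<open>(1 + w + y)\<^sup>\<alpha>\<close> in powers of \<open>w + y\<close>, the right one in powers of \<open>y / (1 + w)\<close>. With \<open>y = z - w\<close> this is
  how the factor \<open>(1 + z)\<^bsup>wt u\<^esup>\<close> is rewritten on the right hand side of the Jacobi identity.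
\<close>

lemma gbinomial_product_convolution:
  fixes \<alpha> \<beta> m :: complex
  shows "(\<Sum>j\<le>E. (\<alpha> gchoose j) * (\<beta> gchoose (E - j)) * ((m + of_nat j) gchoose K))
    = (\<Sum>i\<le>K. if i \<le> E then (m gchoose (K - i)) * (\<alpha> gchoose i) * ((\<alpha> + \<beta> - of_nat i) gchoose (E - i))
        else 0)"
proof -
  have term_eq: "(\<alpha> gchoose j) * (of_nat j gchoose i)
      = (if i \<le> j then (\<alpha> gchoose i) * ((\<alpha> - of_nat i) gchoose (j - i)) else 0)" for i j
  proof (cases "i \<le> j")
    case False
    then have "(of_nat j gchoose i :: complex) = 0" by (simp flip: binomial_gbinomial)
    then show ?thesis using False by simp
  qed (simp add: gbinomial_trinomial_revision)
  have "(\<Sum>j\<le>E. (\<alpha> gchoose j) * (\<beta> gchoose (E - j)) * ((m + of_nat j) gchoose K))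
    = (\<Sum>j\<le>E. (\<alpha> gchoose j) * (\<beta> gchoose (E - j)) *
        (\<Sum>i\<le>K. (of_nat j gchoose i) * (m gchoose (K - i))))"
    by (simp add: gbinomial_Vandermonde_atMost add.commute)
  also have "\<dots> = (\<Sum>j\<le>E. \<Sum>i\<le>K. (m gchoose (K - i)) * (\<beta> gchoose (E - j)) *
        ((\<alpha> gchoose j) * (of_nat j gchoose i)))"
    by (simp add: sum_distrib_left mult_ac)
  also have "\<dots> = (\<Sum>i\<le>K. \<Sum>j\<le>E. (m gchoose (K - i)) * (\<beta> gchoose (E - j)) *
        ((\<alpha> gchoose j) * (of_nat j gchoose i)))"
    by (rule sum.swap)
  also have "\<dots> = (\<Sum>i\<le>K. if i \<le> E then (m gchoose (K - i)) * (\<alpha> gchoose i) *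
      ((\<alpha> + \<beta> - of_nat i) gchoose (E - i)) else 0)"
  proof (rule sum.cong[OF refl])
    fix i
    show "(\<Sum>j\<le>E. (m gchoose (K - i)) * (\<beta> gchoose (E - j)) * ((\<alpha> gchoose j) * (of_nat j gchoose i)))
      = (if i \<le> E then (m gchoose (K - i)) * (\<alpha> gchoose i) *
          ((\<alpha> + \<beta> - of_nat i) gchoose (E - i)) else 0)"
    proof (cases "i \<le> E")
      case True
      have "(\<Sum>j\<le>E. (m gchoose (K - i)) * (\<beta> gchoose (E - j)) * ((\<alpha> gchoose j) * (of_nat j gchoose i)))
        = (\<Sum>j\<in>{i..E}. (m gchoose (K - i)) * (\<beta> gchoose (E - j)) *
            ((\<alpha> gchoose i) * ((\<alpha> - of_nat i) gchoose (j - i))))"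
        by (rule sum.mono_neutral_cong_right) (auto simp: term_eq)
      also have "\<dots> = (\<Sum>j\<le>E - i. (m gchoose (K - i)) * (\<beta> gchoose (E - i - j)) *
            ((\<alpha> gchoose i) * ((\<alpha> - of_nat i) gchoose j)))"
        by (rule sum.reindex_bij_witness[of _ "\<lambda>j. j + i" "\<lambda>j. j - i"]) (use True in auto)
      also have "\<dots> = (m gchoose (K - i)) * (\<alpha> gchoose i) *
          (\<Sum>j\<le>E - i. ((\<alpha> - of_nat i) gchoose j) * (\<beta> gchoose (E - i - j)))"
        by (simp add: sum_distrib_left mult_ac)
      also have "\<dots> = (m gchoose (K - i)) * (\<alpha> gchoose i) * ((\<alpha> + \<beta> - of_nat i) gchoose (E - i))"
        by (simp only: gbinomial_Vandermonde_atMost) (simp add: diff_add_eq)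
      finally show ?thesis using True by simp
    qed (simp add: term_eq)
  qed
  finally show ?thesis .
qed

section \<open>Weights\<close>

context dg_vertex_operator_algebra
begin

lemma weight_space_subspace: "subspace (weight_space k)"
  unfolding weight_space_def
  by (auto simp: subspace_def undeformed.P_add_right undeformed.P_scale_right scale_right_distrib
      mult.commute)

sublocale weight: graded_vector_space scale weight_space
  using weight_direct_sum weight_space_subspace
  by unfold_locales (auto simp: weight_space_def[abs_def])

text \<open>
  The identity \<open>(L(-1)v)\<^sub>n = -n v\<^bsub>n-1\<^esub>\<close>. The iterate formula with the vacuum leaves at
  most one term, of the form \<open>v\<^bsub>-2-i\<^esub> (1\<^bsub>n+i\<^esub> w)\<close> for \<open>n < 0\<close> and \<open>1\<^bsub>n-2-i\<^esub> (v\<^sub>i w)\<close> for \<open>n > 0\<close>.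
\<close>

lemma translation_mode: "Y (Y v (-2) vac) n w = (- of_int n) *s Y v (n - 1) w"
proof (induction v rule: degree.homogeneous_induct)
  case (homogeneous p v)
  define f where "f i = of_nat (Suc i) *s (Y v (-2 - int i) (Y vac (n + int i) w)
      - Y vac (n - 2 - int i) (Y v (int i) w))" for i
  have zero: "f i = 0" if "int i \<noteq> -1 - n" "int i \<noteq> n - 1" for i
    using that by (auto simp: f_def vacuum)
  have "\<forall>\<^sub>F N in sequentially. Y (Y v (-2) vac) n w = (- of_int n) *s Y v (n - 1) w"
    using undeformed.minus_two_iterate[OF homogeneous vac_degree, of n w]
      eventually_gt_at_top[of "nat \<bar>n\<bar>"]
  proof eventually_elim
    case (elim N)
    have "Y (Y v (-2) vac) n w = sum f {..<N}"
      using elim(1) by (simp add: f_def)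
    also have "\<dots> = (- of_int n) *s Y v (n - 1) w"
    proof (cases "n = 0")
      case True
      then show ?thesis using zero by (simp add: sum.neutral)
    next
      case False
      define i where "i = (if n > 0 then nat (n - 1) else nat (-1 - n))"
      have "sum f {..<N} = sum f {i}"
        by (rule sum.mono_neutral_right) (use elim(2) False in \<open>auto simp: i_def intro!: zero\<close>)
      also have "\<dots> = (- of_int n) *s Y v (n - 1) w"
      proof (cases "n > 0")
        case True
        then have "int (Suc i) = n" "int i = n - 1" by (auto simp: i_def)
        moreover from this have "(of_int n :: complex) = 1 + of_nat i"
          by (metis of_int_of_nat_eq of_nat_Suc)
        ultimately show ?thesis
          using True by (simp add: f_def vacuum undeformed.P_zero_right flip: scale_minus_left)
      next
        case neg: False
        then have "int (Suc i) = - n" "n + int i = -1" "-2 - int i = n - 1" using False by (auto simp: i_def)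
        moreover from this have "- (of_int n :: complex) = 1 + of_nat i"
          by (metis of_int_minus of_int_of_nat_eq of_nat_Suc)
        moreover have "Y v (-2 - int i) w = Y v (n - 1) w"
          by (simp only: \<open>-2 - int i = n - 1\<close>)
        ultimately show ?thesis
          using neg by (simp add: f_def vacuum undeformed.P_zero_right)
      qed
      finally show ?thesis .
    qed
    finally show ?case .
  qed
  then show ?case by (simp add: eventually_const_iff)
qed (simp add: undeformed.P_add_left scale_right_distrib)

text \<open>
  The commutator \<open>[L(0), v\<^sub>n] = (L(-1)v)\<^bsub>n+1\<^esub> + (L(0)v)\<^sub>n\<close>, where \<open>\<omega>\<^sub>0 = L(-1)\<close> and \<open>\<omega>\<^sub>1 = L(0)\<close>.
\<close>

lemma weight_commutator:
  "Y \<omega> 1 (Y v n w) = Y v n (Y \<omega> 1 w) + Y (Y \<omega> 1 v) n w - of_int (n + 1) *s Y v n w"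
proof (induction v rule: degree.homogeneous_induct)
  case (homogeneous q v)
  have "\<forall>\<^sub>F N in sequentially. Y \<omega> 1 (Y v n w) - Y v n (Y \<omega> 1 w)
      = Y (Y \<omega> 1 v) n w - of_int (n + 1) *s Y v n w"
    using commutator_modes[OF omega_degree homogeneous, of 1 n w] eventually_gt_at_top[of 1]
  proof eventually_elim
    case (elim N)
    have "(\<Sum>k<N. (of_int 1 gchoose k) *s Y (Y \<omega> (int k) v) (1 + n - int k) w)
        = (\<Sum>k\<in>{0,1}. (of_int 1 gchoose k) *s Y (Y \<omega> (int k) v) (1 + n - int k) w)"
    proof (rule sum.mono_neutral_right)
      have "(1 gchoose k :: complex) = 0" if "k > 1" for k
        using that binomial_eq_0[of 1 k] binomial_gbinomial[of 1 k, where 'a = complex]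
        by (metis of_nat_0 of_nat_1)
      then show "\<forall>k\<in>{..<N} - {0,1}. (of_int 1 gchoose k) *s Y (Y \<omega> (int k) v) (1 + n - int k) w = 0"
        by auto
    qed (use elim(2) in auto)
    then have "Y \<omega> 1 (Y v n w) - ((-1) powi (4 * q)) *s Y v n (Y \<omega> 1 w)
        = Y (Y v (-2) vac) (1 + n) w + Y (Y \<omega> 1 v) n w"
      using elim(1) by (simp add: translation)
    moreover have "(-1) powi (4 * q) = (1 :: complex)" by (simp add: power_int_minus_left)
    moreover have "- of_int (1 + n) *s x = - (of_int (n + 1) *s x)" for x
      by (simp only: scale_minus_left add.commute)
    ultimately show ?case by (simp add: translation_mode del: of_int_add)
  qed
  then show ?case by (simp add: eventually_const_iff algebra_simps)
qed (simp add: undeformed.P_add_left undeformed.P_add_right scale_right_distrib)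

lemma Y_weight:
  assumes "u \<in> weight_space j" "v \<in> weight_space k"
  shows "Y u n v \<in> weight_space (j + k - 2 * n - 2)"
proof -
  have "Y \<omega> 1 (Y u n v) = (of_int k / 2) *s Y u n v + (of_int j / 2) *s Y u n v
      - of_int (n + 1) *s Y u n v"
    using assms weight_commutator[of u n v]
    by (simp add: weight_space_def undeformed.P_scale_left undeformed.P_scale_right)
  also have "\<dots> = (of_int (j + k - 2 * n - 2) / 2) *s Y u n v"
    by (simp only: flip: scale_left_distrib scale_left_diff_distrib) (simp add: field_simps)
  finally show ?thesis by (simp add: weight_space_def)
qed

lemma vac_weight: "vac \<in> weight_space 0"
  by (simp add: weight_space_def creation_regular)

lemma d_weight: "u \<in> weight_space k \<Longrightarrow> d u \<in> weight_space k"
  using d_Y[OF omega_degree, of 1 u]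
  by (simp add: weight_space_def omega_d undeformed.P_zero_left d_scale)

text \<open>Since \<open>L(0)\<close> has degree zero, the two gradings refine each other.\<close>

lemma component_weight_degree:
  assumes "u \<in> deg p"
  shows "component weight_space u k \<in> deg p"
proof -
  have comm: "component deg (Y \<omega> 1 x) q = Y \<omega> 1 (component deg x q)" for x q
  proof (induction x rule: degree.homogeneous_induct)
    case (homogeneous r x)
    have "Y \<omega> 1 x \<in> deg r" using Y_degree[OF omega_degree homogeneous, of 1] by simp
    from degree.component_homogeneous[OF this] show ?case
      by (simp add: degree.component_homogeneous[OF homogeneous]
          undeformed.P_zero_right)
  qed (simp add: degree.component_add undeformed.P_add_right)
  have *: "component weight_space (component deg u q) = (\<lambda>k. component deg (component weight_space u k) q)"
    for q
  proof (rule weight.component_superset_eqI[OF weight.finite_component[of u]])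
    show "component deg (component weight_space u k) q \<in> weight_space k" for k
      using comm[of "component weight_space u k" q] weight.component_in[of u k]
      by (simp add: weight_space_def degree.component_scale)
    show "component deg u q = (\<Sum>k | component weight_space u k \<noteq> 0.
        component deg (component weight_space u k) q)"
      by (simp add: weight.sum_component flip: degree.component_sum)
  qed (simp add: degree.component_0)
  have "component deg (component weight_space u k) q = 0" if "q \<noteq> p" for q
    using fun_cong[OF *[of q], of k] that assms
    by (simp add: degree.component_homogeneous weight.component_0)
  then have "component weight_space u k = component deg (component weight_space u k) p"
    using degree.sum_component_superset[of "{p}" "component weight_space u k"] by force
  then show ?thesis using degree.component_in by metis
qed

lemma bihomogeneous_induct [consumes 1, case_names homogeneous add]:
  assumes u: "u \<in> deg p"
    and hom: "\<And>k v. v \<in> deg p \<Longrightarrow> v \<in> weight_space k \<Longrightarrow> Q v"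
    and add: "\<And>v w. Q v \<Longrightarrow> Q w \<Longrightarrow> Q (v + w)"
  shows "Q u"
proof -
  have zero: "Q 0" using hom[of 0 0] by (simp add: subspace_0 deg_subspace weight_space_subspace)
  have "Q (\<Sum>k\<in>A. component weight_space u k)" if "finite A" for A
    using that
    by induction (auto intro: zero add hom component_weight_degree[OF u] weight.component_in)
  from this[OF weight.finite_component[of u]] show ?thesis by (simp add: weight.sum_component)
qed

end

section \<open>The products of the Zhu algebra\<close>

lemma sum_swap3:
  "(\<Sum>i\<in>A. \<Sum>j\<in>B. \<Sum>k\<in>C. F i j k) = (\<Sum>j\<in>B. \<Sum>k\<in>C. \<Sum>i\<in>A. F i j k)"
proof -
  have "(\<Sum>i\<in>A. \<Sum>j\<in>B. \<Sum>k\<in>C. F i j k) = (\<Sum>j\<in>B. \<Sum>i\<in>A. \<Sum>k\<in>C. F i j k)"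
    by (rule sum.swap)
  also have "\<dots> = (\<Sum>j\<in>B. \<Sum>k\<in>C. \<Sum>i\<in>A. F i j k)"
    by (intro sum.cong refl sum.swap)
  finally show ?thesis .
qed

context dg_vertex_algebra
begin

lemma truncation_uniform:
  assumes "finite A"
  shows "\<exists>M::nat. \<forall>(u, v)\<in>A. \<forall>i\<ge>M. \<forall>n\<ge>b. Y u (n + int i) v = 0"
  using assms
proof induction
  case (insert x A)
  obtain u v where x: "x = (u, v)" by fastforce
  from insert obtain M where M: "\<forall>(u, v)\<in>A. \<forall>i\<ge>M. \<forall>n\<ge>b. Y u (n + int i) v = 0" by blast
  obtain N where N: "\<And>n. n \<ge> N \<Longrightarrow> Y u n v = 0" using truncation by blast
  have "\<forall>(u, v)\<in>insert x A. \<forall>i\<ge>max M (nat (N - b)). \<forall>n\<ge>b. Y u (n + int i) v = 0"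
    using M by (auto simp: x intro!: N)
  then show ?case by blast
qed simp

text \<open>
  The coefficient of \<open>x\<^bsup>-m-1\<^esup>\<close> in \<open>(1 + x)\<^sup>c Y(u,x) v\<close>.
\<close>

definition mode_sum :: "complex \<Rightarrow> 'v \<Rightarrow> int \<Rightarrow> 'v \<Rightarrow> 'v" where
  "mode_sum c u m v = Sum_any (\<lambda>i::nat. (c gchoose i) *s Y u (m + int i) v)"

lemma mode_sum_eq:
  assumes "\<And>i. i \<ge> M \<Longrightarrow> Y u (m + int i) v = 0" "M \<le> N"
  shows "mode_sum c u m v = (\<Sum>i<N. (c gchoose i) *s Y u (m + int i) v)"
  unfolding mode_sum_def by (rule Sum_any_eq_sum_lessThan[OF _ assms(2)]) (simp add: assms(1))

lemma eventually_mode_sum: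
  "\<forall>\<^sub>F N in sequentially. mode_sum c u m v = (\<Sum>i<N. (c gchoose i) *s Y u (m + int i) v)"
proof -
  obtain M :: nat where "\<forall>i\<ge>M. \<forall>n\<ge>m. Y u (n + int i) v = 0"
    using truncation_uniform[of "{(u, v)}" m] by auto
  then have M: "\<And>i. i \<ge> M \<Longrightarrow> Y u (m + int i) v = 0" by blast
  show ?thesis
    using eventually_ge_at_top[of M]
  proof eventually_elim
    case (elim N)
    show ?case by (rule mode_sum_eq[OF M elim])
  qed
qed

lemma mode_sum_add_left: "mode_sum c (u + u') m v = mode_sum c u m v + mode_sum c u' m v"
proof -
  have "\<forall>\<^sub>F N in sequentially. mode_sum c (u + u') m v = mode_sum c u m v + mode_sum c u' m v"
    using eventually_mode_sum[of c u m v] eventually_mode_sum[of c u' m v]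
      eventually_mode_sum[of c "u + u'" m v]
    by eventually_elim (simp add: undeformed.P_add_left scale_right_distrib sum.distrib)
  then show ?thesis by (simp add: eventually_const_iff)
qed

lemma mode_sum_add_right: "mode_sum c u m (v + v') = mode_sum c u m v + mode_sum c u m v'"
proof -
  have "\<forall>\<^sub>F N in sequentially. mode_sum c u m (v + v') = mode_sum c u m v + mode_sum c u m v'"
    using eventually_mode_sum[of c u m v] eventually_mode_sum[of c u m v']
      eventually_mode_sum[of c u m "v + v'"]
    by eventually_elim (simp add: undeformed.P_add_right scale_right_distrib sum.distrib)
  then show ?thesis by (simp add: eventually_const_iff)
qed

lemma mode_sum_scale_left: "mode_sum c (a *s u) m v = a *s mode_sum c u m v"
proof -
  have "\<forall>\<^sub>F N in sequentially. mode_sum c (a *s u) m v = a *s mode_sum c u m v"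
    using eventually_mode_sum[of c u m v] eventually_mode_sum[of c "a *s u" m v]
    by eventually_elim (simp add: undeformed.P_scale_left scale_sum_right mult.commute)
  then show ?thesis by (simp add: eventually_const_iff)
qed

lemma mode_sum_scale_right: "mode_sum c u m (a *s v) = a *s mode_sum c u m v"
proof -
  have "\<forall>\<^sub>F N in sequentially. mode_sum c u m (a *s v) = a *s mode_sum c u m v"
    using eventually_mode_sum[of c u m v] eventually_mode_sum[of c u m "a *s v"]
    by eventually_elim (simp add: undeformed.P_scale_right scale_sum_right mult.commute)
  then show ?thesis by (simp add: eventually_const_iff)
qed

lemma mode_sum_zero_left: "mode_sum c 0 m v = 0"
  using mode_sum_scale_left[of c 0 0 m v] by simp

end

context dg_vertex_operator_algebra
begin

text \<open>
  The products of the deformed field \<open>(1 + x)\<^bsup>wt u\<^esup> Y(u,x)\<close>. Index \<open>-1\<close> gives the product of the Zhu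
  algebra and index \<open>-2\<close> the generators of \<open>O(V)\<close>.
\<close>

definition zhu_prod :: "'v \<Rightarrow> int \<Rightarrow> 'v \<Rightarrow> 'v" where
  "zhu_prod u m v = Sum_any (\<lambda>k::int. mode_sum (of_int k / 2) (component weight_space u k) m v)"

lemma zhu_mult_eq: "zhu_mult u v = zhu_prod u (-1) v"
  by (simp add: zhu_mult_def zhu_prod_def mode_sum_def add.commute)

lemma zhu_circ_eq: "zhu_circ u v = zhu_prod u (-2) v"
  by (simp add: zhu_circ_def zhu_prod_def mode_sum_def add.commute)

lemma zhu_prod_eq_sum:
  assumes "finite A" "{k. component weight_space u k \<noteq> 0} \<subseteq> A"
  shows "zhu_prod u m v = (\<Sum>k\<in>A. mode_sum (of_int k / 2) (component weight_space u k) m v)"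
  unfolding zhu_prod_def
  by (rule Sum_any.expand_superset) (use assms in \<open>auto simp: mode_sum_zero_left\<close>)

lemma zhu_prod_homogeneous:
  assumes "u \<in> weight_space k"
  shows "zhu_prod u m v = mode_sum (of_int k / 2) u m v"
proof -
  have "{j. component weight_space u j \<noteq> 0} \<subseteq> {k}"
    by (auto simp: weight.component_homogeneous[OF assms] split: if_splits)
  from zhu_prod_eq_sum[OF _ this] show ?thesis
    by (simp add: weight.component_homogeneous[OF assms])
qed

lemma zhu_prod_add_left: "zhu_prod (u + u') m v = zhu_prod u m v + zhu_prod u' m v"
proof -
  define A where "A = {k. component weight_space u k \<noteq> 0} \<union> {k. component weight_space u' k \<noteq> 0}"
  have A: "finite A" "{k. component weight_space u k \<noteq> 0} \<subseteq> A"
    "{k. component weight_space u' k \<noteq> 0} \<subseteq> A" "{k. component weight_space (u + u') k \<noteq> 0} \<subseteq> A"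
    by (auto simp: A_def weight.finite_component weight.component_add)
  show ?thesis
    unfolding zhu_prod_eq_sum[OF A(1,2)] zhu_prod_eq_sum[OF A(1,3)]
      zhu_prod_eq_sum[OF A(1,4)]
    by (simp add: weight.component_add mode_sum_add_left sum.distrib)
qed

lemma zhu_prod_scale_left: "zhu_prod (c *s u) m v = c *s zhu_prod u m v"
proof -
  have "{k. component weight_space (c *s u) k \<noteq> 0} \<subseteq> {k. component weight_space u k \<noteq> 0}"
    by (auto simp: weight.component_scale)
  from zhu_prod_eq_sum[OF weight.finite_component this]
    zhu_prod_eq_sum[OF weight.finite_component order_refl]
  show ?thesis by (simp add: weight.component_scale mode_sum_scale_left scale_sum_right)
qed

lemma zhu_prod_add_right: "zhu_prod u m (v + v') = zhu_prod u m v + zhu_prod u m v'"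
  using zhu_prod_eq_sum[OF weight.finite_component order_refl, of u m]
  by (simp add: mode_sum_add_right sum.distrib)

lemma zhu_prod_scale_right: "zhu_prod u m (c *s v) = c *s zhu_prod u m v"
  using zhu_prod_eq_sum[OF weight.finite_component order_refl, of u m]
  by (simp add: mode_sum_scale_right scale_sum_right)

lemma zhu_prod_zero_left: "zhu_prod 0 m v = 0" and zhu_prod_zero_right: "zhu_prod u m 0 = 0"
  using zhu_prod_scale_left[of 0 0 m v] zhu_prod_scale_right[of u m 0 0] by auto

lemma zhu_prod_sum_left: "zhu_prod (sum f A) m v = (\<Sum>a\<in>A. zhu_prod (f a) m v)"
  by (induction A rule: infinite_finite_induct) (auto simp: zhu_prod_zero_left zhu_prod_add_left)

lemma zhu_prod_sum_right: "zhu_prod u m (sum f A) = (\<Sum>a\<in>A. zhu_prod u m (f a))"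
  by (induction A rule: infinite_finite_induct) (auto simp: zhu_prod_zero_right zhu_prod_add_right)

lemma zhu_prod_truncation: "\<exists>N. \<forall>n\<ge>N. zhu_prod u n v = 0"
proof (induction u rule: weight.homogeneous_induct)
  case (homogeneous k u)
  obtain N where "\<forall>n\<ge>N. Y u n v = 0" using truncation by blast
  then show ?case
    by (intro exI[of _ N]) (auto simp: zhu_prod_homogeneous[OF homogeneous] mode_sum_def)
next
  case (add u u')
  then obtain N N' where "\<forall>n\<ge>N. zhu_prod u n v = 0" "\<forall>n\<ge>N'. zhu_prod u' n v = 0" by blast
  then show ?case by (intro exI[of _ "max N N'"]) (auto simp: zhu_prod_add_left)
qed

lemma zhu_prod_vacuum: "zhu_prod vac n v = (if n = -1 then v else 0)"
proof -
  have "zhu_prod vac n v = Sum_any (\<lambda>i::nat. if i = 0 then Y vac n v else 0)"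
    unfolding zhu_prod_homogeneous[OF vac_weight] mode_sum_def
    by (rule Sum_any.cong) (auto simp: gbinomial_0_left)
  also have "\<dots> = Y vac n v"
    by (subst Sum_any.expand_superset[of "{0}"]) auto
  finally show ?thesis by (simp add: vacuum)
qed

lemma zhu_prod_creation_regular: "n \<ge> 0 \<Longrightarrow> zhu_prod u n vac = 0"
proof (induction u rule: weight.homogeneous_induct)
  case (homogeneous k u)
  then show ?case by (simp add: zhu_prod_homogeneous mode_sum_def creation_regular)
qed (simp add: zhu_prod_add_left)

lemma zhu_prod_creation_constant: "zhu_prod u (-1) vac = u"
proof (induction u rule: weight.homogeneous_induct)
  case (homogeneous k u)
  have "zhu_prod u (-1) vac = Sum_any (\<lambda>i::nat. if i = 0 then u else 0)"
    unfolding zhu_prod_homogeneous[OF homogeneous] mode_sum_def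
    by (rule Sum_any.cong) (auto simp: creation_regular creation_constant)
  also have "\<dots> = u"
    by (subst Sum_any.expand_superset[of "{0}"]) auto
  finally show ?case .
qed (simp add: zhu_prod_add_left)

text \<open>
  Expanding the factors \<open>(1 + x)\<^sup>\<alpha>\<close> and \<open>(1 + x)\<^sup>\<beta>\<close>, \<open>\<alpha> = wt u\<close>, \<open>\<beta> = wt v\<close>, turns both sides into combinations
  of the vectors \<open>G K E = (u\<^bsub>l+K\<^esub> v)\<^bsub>m+n-K+E\<^esub> w\<close>. On the left this uses the Jacobi identity of \<open>V\<close> for every
  pair of shifted indices \<open>m + j\<close>, \<open>n + t\<close>. On the right \<open>u\<^bsub>l+k+i\<^esub> v\<close> has weight
  \<open>\<alpha> + \<beta> - (l + k + i) - 1\<close>, which the exponent \<open>l + k + 1\<close> in the deformed identity completes to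
  \<open>\<alpha> + \<beta> - i\<close> by Vandermonde. The coefficients agree by \<open>gbinomial_product_convolution\<close>.
\<close>

lemma zhu_prod_jacobi_bihomogeneous:
  assumes deg: "u \<in> deg p" "v \<in> deg q" and wt: "u \<in> weight_space a" "v \<in> weight_space b"
  shows "\<forall>\<^sub>F N in sequentially.
    (\<Sum>i<N. ((-1) ^ i * (of_int l gchoose i)) *s
        (zhu_prod u (m + l - int i) (zhu_prod v (n + int i) w)
          - ((-1) powi l * (-1) powi (p * q)) *s
            zhu_prod v (n + l - int i) (zhu_prod u (m + int i) w)))
    = (\<Sum>k<N. (of_int m gchoose k) *s (\<Sum>s<N. (of_int (l + int k + 1) gchoose s) *s
        zhu_prod (zhu_prod u (l + int k) v) (m + n - int k + int s) w))"
proof -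
  define \<alpha> \<beta> :: complex where "\<alpha> = of_int a / 2" and "\<beta> = of_int b / 2"
  define \<epsilon> :: complex where "\<epsilon> = (-1) powi l * (-1) powi (p * q)"
  define G where "G K E = Y (Y u (l + int K) v) (m + n - int K + int E) w" for K E
  obtain N1 where N1: "\<And>N m' n'. N \<ge> N1 \<Longrightarrow> m' \<ge> m \<Longrightarrow> n' \<ge> n \<Longrightarrow>
    (\<Sum>i<N. ((-1) ^ i * (of_int l gchoose i)) *s
        (Y u (m' + l - int i) (Y v (n' + int i) w)
          - \<epsilon> *s Y v (n' + l - int i) (Y u (m' + int i) w)))
    = (\<Sum>k<N. (of_int m' gchoose k) *s Y (Y u (l + int k) v) (m' + n' - int k) w)"
    using jacobi_uniform[OF deg, of m n l w] unfolding \<epsilon>_def by blast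
  obtain N2 where N2: "\<And>K. K \<ge> N2 \<Longrightarrow> Y u (l + int K) v = 0"
    using truncation_uniform[of "{(u, v)}" l] by auto
  have "finite ((\<lambda>K. (Y u (l + int K) v, w)) ` {..<N2})" by simp
  from truncation_uniform[OF this, of "m + n - int N2"]
  obtain N3 where "\<forall>(x, y)\<in>(\<lambda>K. (Y u (l + int K) v, w)) ` {..<N2}.
      \<forall>i\<ge>N3. \<forall>r\<ge>m + n - int N2. Y x (r + int i) y = 0" by blast
  then have N3: "G K E = 0" if "K < N2" "E \<ge> N3" for K E
    using that unfolding G_def by auto
  have u_mode: "zhu_prod u r x = (\<Sum>j<M. (\<alpha> gchoose j) *s Y u (r + int j) x)"
    if "\<And>j. j \<ge> M \<Longrightarrow> Y u (r + int j) x = 0" for r x M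
    unfolding zhu_prod_homogeneous[OF wt(1)] \<alpha>_def by (rule mode_sum_eq[OF that order_refl])
  have v_mode: "zhu_prod v r x = (\<Sum>j<M. (\<beta> gchoose j) *s Y v (r + int j) x)"
    if "\<And>j. j \<ge> M \<Longrightarrow> Y v (r + int j) x = 0" for r x M
    unfolding zhu_prod_homogeneous[OF wt(2)] \<beta>_def by (rule mode_sum_eq[OF that order_refl])
  have "\<forall>\<^sub>F N in sequentially. N \<ge> max N1 (max N2 N3)" by (rule eventually_ge_at_top)
  then show ?thesis
  proof eventually_elim
    case (elim N)
    then have N: "N \<ge> N1" "N \<ge> N2" "N \<ge> N3" by auto
    have G0: "G K E = 0" if "K \<ge> N \<or> E \<ge> N" for K E
    proof (cases "K < N2")
      case False
      then show ?thesis using N2[of K] by (simp add: G_def undeformed.P_zero_left)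
    qed (use that N N3 in auto)
    obtain M1' where M1': "\<And>i r. i \<ge> M1' \<Longrightarrow> r \<ge> n \<Longrightarrow> Y v (r + int i) w = 0"
      using truncation_uniform[of "{(v, w)}" n] by auto
    obtain M1'' where M1'': "\<And>i r. i \<ge> M1'' \<Longrightarrow> r \<ge> m \<Longrightarrow> Y u (r + int i) w = 0"
      using truncation_uniform[of "{(u, w)}" m] by auto
    define M1 where "M1 = max M1' M1''"
    have M1: "i \<ge> M1 \<Longrightarrow> r \<ge> n \<Longrightarrow> Y v (r + int i) w = 0"
      "i \<ge> M1 \<Longrightarrow> r \<ge> m \<Longrightarrow> Y u (r + int i) w = 0" for i r
      using M1' M1'' by (auto simp: M1_def)
    define B where "B = (\<lambda>(i, t). (u, Y v (n + int i + int t) w)) ` ({..<N} \<times> {..<M1})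
      \<union> (\<lambda>(i, t). (v, Y u (m + int i + int t) w)) ` ({..<N} \<times> {..<M1})"
    have "finite B" by (simp add: B_def)
    from truncation_uniform[OF this, of "min m n + l - int N"]
    obtain M2 where *: "\<forall>(x, y)\<in>B. \<forall>j\<ge>M2. \<forall>r\<ge>min m n + l - int N. Y x (r + int j) y = 0"
      by blast
    have M2: "Y u (m + l - int i + int j) (Y v (n + int i + int t) w) = 0"
      "Y v (n + l - int i + int j) (Y u (m + int i + int t) w) = 0"
      if "i < N" "t < M1" "j \<ge> M2" for i t j
    proof -
      have "(u, Y v (n + int i + int t) w) \<in> B" "(v, Y u (m + int i + int t) w) \<in> B"
        using that by (auto simp: B_def)
      then show "Y u (m + l - int i + int j) (Y v (n + int i + int t) w) = 0"
        "Y v (n + l - int i + int j) (Y u (m + int i + int t) w) = 0"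
        using * that by auto
    qed
    \<comment> \<open>beyond \<open>M\<close> all double products of modes of \<open>u\<close> and \<open>v\<close> on \<open>w\<close> that occur for \<open>i < N\<close> vanish;
      it depends on \<open>N\<close>, as the inner products range over \<open>i < N\<close>\<close>
    define M where "M = max N (max M1 M2)"
    have Z1: "zhu_prod u (m + l - int i) (zhu_prod v (n + int i) w) =
        (\<Sum>j<M. \<Sum>t<M. ((\<alpha> gchoose j) * (\<beta> gchoose t)) *s
          Y u (m + int j + l - int i) (Y v (n + int t + int i) w))" if "i < N" for i
    proof -
      have "Y u (m + l - int i + int j) (Y v (n + int i + int t) w) = 0" if "j \<ge> M" for j t
        using M2(1)[OF \<open>i < N\<close>, of t j] M1(1)[of t "n + int i"] that
        by (cases "t < M1") (auto simp: M_def undeformed.P_zero_right)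
      then have "zhu_prod u (m + l - int i) (Y v (n + int i + int t) w) =
          (\<Sum>j<M. (\<alpha> gchoose j) *s Y u (m + l - int i + int j) (Y v (n + int i + int t) w))" for t
        by (intro u_mode)
      moreover have "zhu_prod v (n + int i) w = (\<Sum>t<M. (\<beta> gchoose t) *s Y v (n + int i + int t) w)"
        by (rule v_mode) (use M1(1) in \<open>auto simp: M_def\<close>)
      ultimately have "zhu_prod u (m + l - int i) (zhu_prod v (n + int i) w) =
        (\<Sum>t<M. \<Sum>j<M. ((\<alpha> gchoose j) * (\<beta> gchoose t)) *s
          Y u (m + l - int i + int j) (Y v (n + int i + int t) w))"
        by (simp add: zhu_prod_sum_right zhu_prod_scale_right scale_sum_right mult.commute)
      then show ?thesis by (subst sum.swap) (simp add: algebra_simps)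
    qed
    have Z2: "zhu_prod v (n + l - int i) (zhu_prod u (m + int i) w) =
        (\<Sum>j<M. \<Sum>t<M. ((\<alpha> gchoose j) * (\<beta> gchoose t)) *s
          Y v (n + int t + l - int i) (Y u (m + int j + int i) w))" if "i < N" for i
    proof -
      have "Y v (n + l - int i + int j) (Y u (m + int i + int t) w) = 0" if "j \<ge> M" for j t
        using M2(2)[OF \<open>i < N\<close>, of t j] M1(2)[of t "m + int i"] that
        by (cases "t < M1") (auto simp: M_def undeformed.P_zero_right)
      then have "zhu_prod v (n + l - int i) (Y u (m + int i + int t) w) =
          (\<Sum>j<M. (\<beta> gchoose j) *s Y v (n + l - int i + int j) (Y u (m + int i + int t) w))" for t
        by (intro v_mode)
      moreover have "zhu_prod u (m + int i) w = (\<Sum>t<M. (\<alpha> gchoose t) *s Y u (m + int i + int t) w)"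
        by (rule u_mode) (use M1(2) in \<open>auto simp: M_def\<close>)
      ultimately have "zhu_prod v (n + l - int i) (zhu_prod u (m + int i) w) =
        (\<Sum>t<M. \<Sum>j<M. ((\<alpha> gchoose t) * (\<beta> gchoose j)) *s
          Y v (n + l - int i + int j) (Y u (m + int i + int t) w))"
        by (simp add: zhu_prod_sum_right zhu_prod_scale_right scale_sum_right mult.commute)
      then show ?thesis by (simp add: algebra_simps)
    qed
    have "(\<Sum>i<N. ((-1) ^ i * (of_int l gchoose i)) *s
        (zhu_prod u (m + l - int i) (zhu_prod v (n + int i) w)
          - \<epsilon> *s zhu_prod v (n + l - int i) (zhu_prod u (m + int i) w)))
      = (\<Sum>i<N. \<Sum>j<M. \<Sum>t<M. ((\<alpha> gchoose j) * (\<beta> gchoose t)) *s (((-1) ^ i * (of_int l gchoose i)) *s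
          (Y u (m + int j + l - int i) (Y v (n + int t + int i) w)
            - \<epsilon> *s Y v (n + int t + l - int i) (Y u (m + int j + int i) w))))"
      by (intro sum.cong refl)
        (simp add: Z1 Z2 scale_right_diff_distrib scale_sum_right sum_subtractf mult_ac)
    also have "\<dots> = (\<Sum>j<M. \<Sum>t<M. ((\<alpha> gchoose j) * (\<beta> gchoose t)) *s
        (\<Sum>i<N. ((-1) ^ i * (of_int l gchoose i)) *s
          (Y u (m + int j + l - int i) (Y v (n + int t + int i) w)
            - \<epsilon> *s Y v (n + int t + l - int i) (Y u (m + int j + int i) w))))"
      unfolding scale_sum_right by (rule sum_swap3)
    also have "\<dots> = (\<Sum>j<M. \<Sum>t<M. ((\<alpha> gchoose j) * (\<beta> gchoose t)) *s
        (\<Sum>K<N. (of_int (m + int j) gchoose K) *s G K (j + t)))"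
    proof -
      have "(\<Sum>i<N. ((-1) ^ i * (of_int l gchoose i)) *s
          (Y u (m + int j + l - int i) (Y v (n + int t + int i) w)
            - \<epsilon> *s Y v (n + int t + l - int i) (Y u (m + int j + int i) w)))
        = (\<Sum>K<N. (of_int (m + int j) gchoose K) *s G K (j + t))" for j t
      proof -
        have "m + int j + (n + int t) - int K = m + n - int K + int (j + t)" for K by simp
        then show ?thesis
          using N1[OF N(1), of "m + int j" "n + int t"] by (simp only: G_def)
      qed
      then show ?thesis by (simp only:)
    qed
    also have "\<dots> = (\<Sum>K<N. \<Sum>j<M. \<Sum>t<M.
        ((\<alpha> gchoose j) * (\<beta> gchoose t) * (of_int (m + int j) gchoose K)) *s G K (j + t))"
      unfolding scale_sum_right scale_scale by (rule sum_swap3[symmetric])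
    also have "\<dots> = (\<Sum>K<N. \<Sum>E<M. (\<Sum>j\<le>E. (\<alpha> gchoose j) * (\<beta> gchoose (E - j)) *
        ((of_int m + of_nat j) gchoose K)) *s G K E)"
      by (rule sum.cong[OF refl], subst sum_square_eq_triangle) (auto simp: G0 M_def scale_sum_left)
    also have "\<dots> = (\<Sum>K<N. \<Sum>E<N. (\<Sum>j\<le>E. (\<alpha> gchoose j) * (\<beta> gchoose (E - j)) *
        ((of_int m + of_nat j) gchoose K)) *s G K E)"
      by (rule sum.cong[OF refl], rule sum.mono_neutral_right) (auto simp: M_def G0)
    also have "\<dots> = (\<Sum>K<N. \<Sum>E<N. (\<Sum>i\<le>K. if i \<le> E then (of_int m gchoose (K - i)) * (\<alpha> gchoose i) *
        ((\<alpha> + \<beta> - of_nat i) gchoose (E - i)) else 0) *s G K E)"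
      by (simp only: gbinomial_product_convolution)
    finally have lhs: "(\<Sum>i<N. ((-1) ^ i * (of_int l gchoose i)) *s
        (zhu_prod u (m + l - int i) (zhu_prod v (n + int i) w)
          - \<epsilon> *s zhu_prod v (n + l - int i) (zhu_prod u (m + int i) w))) = \<dots>" .
    have inner: "(\<Sum>s<N. (of_int (l + int k + 1) gchoose s) *s
          zhu_prod (Y u (l + int k + int i) v) (m + n - int k + int s) w)
        = (\<Sum>E<N. (if i \<le> E then (\<alpha> + \<beta> - of_nat i) gchoose (E - i) else 0) *s G (k + i) E)" for k i
    proof -
      define \<gamma> where "\<gamma> = \<alpha> + \<beta> - of_int (l + int k + int i) - 1"
      have wtY: "Y u (l + int k + int i) v \<in> weight_space (a + b - 2 * (l + int k + int i) - 2)"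
        by (rule Y_weight[OF wt])
      have \<gamma>: "of_int (a + b - 2 * (l + int k + int i) - 2) / 2 = \<gamma>"
        by (simp add: \<gamma>_def \<alpha>_def \<beta>_def field_simps)
      have G_eq: "Y (Y u (l + int k + int i) v) (m + n - int k + int s + int e) w = G (k + i) (i + s + e)"
        for s e by (simp add: G_def algebra_simps)
      have "(\<Sum>s<N. (of_int (l + int k + 1) gchoose s) *s
          zhu_prod (Y u (l + int k + int i) v) (m + n - int k + int s) w)
        = (\<Sum>s<N. \<Sum>e<N. ((of_int (l + int k + 1) gchoose s) * (\<gamma> gchoose e)) *s G (k + i) (i + s + e))"
      proof (intro sum.cong refl)
        fix s
        have "zhu_prod (Y u (l + int k + int i) v) (m + n - int k + int s) w
          = (\<Sum>e<N. (\<gamma> gchoose e) *s Y (Y u (l + int k + int i) v) (m + n - int k + int s + int e) w)"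
          unfolding zhu_prod_homogeneous[OF wtY] \<gamma>
          by (rule mode_sum_eq[OF _ order_refl]) (simp only: G_eq, simp add: G0)
        then show "(of_int (l + int k + 1) gchoose s) *s
            zhu_prod (Y u (l + int k + int i) v) (m + n - int k + int s) w
          = (\<Sum>e<N. ((of_int (l + int k + 1) gchoose s) * (\<gamma> gchoose e)) *s G (k + i) (i + s + e))"
          by (simp only: G_eq scale_sum_right scale_scale)
      qed
      also have "\<dots> = (\<Sum>E<N. (\<Sum>s\<le>E. (of_int (l + int k + 1) gchoose s) * (\<gamma> gchoose (E - s))) *s
          G (k + i) (i + E))"
        by (subst sum_square_eq_triangle) (auto simp: G0 scale_sum_left intro!: sum.cong)
      also have "\<dots> = (\<Sum>E<N. ((\<alpha> + \<beta> - of_nat i) gchoose E) *s G (k + i) (i + E))"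
        by (simp only: gbinomial_Vandermonde_atMost) (simp add: \<gamma>_def algebra_simps)
      also have "\<dots> = (\<Sum>E\<in>{i..<N}. ((\<alpha> + \<beta> - of_nat i) gchoose (E - i)) *s G (k + i) E)"
      proof -
        have "(\<Sum>E<N. ((\<alpha> + \<beta> - of_nat i) gchoose E) *s G (k + i) (i + E))
            = (\<Sum>E<N - i. ((\<alpha> + \<beta> - of_nat i) gchoose E) *s G (k + i) (i + E))"
        proof (rule sum.mono_neutral_right)
          have "G (k + i) (i + E) = 0" if "N - i \<le> E" for E
            using that by (intro G0) auto
          then show "\<forall>E\<in>{..<N} - {..<N - i}.
              ((\<alpha> + \<beta> - of_nat i) gchoose E) *s G (k + i) (i + E) = 0" by auto
        qed auto
        also have "\<dots> = (\<Sum>E\<in>{i..<N}. ((\<alpha> + \<beta> - of_nat i) gchoose (E - i)) *s G (k + i) E)"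
          by (rule sum.reindex_bij_witness[of _ "\<lambda>E. E - i" "\<lambda>E. E + i"]) (auto simp: add.commute)
        finally show ?thesis .
      qed
      also have "\<dots> = (\<Sum>E<N. (if i \<le> E then (\<alpha> + \<beta> - of_nat i) gchoose (E - i) else 0) *s G (k + i) E)"
        by (rule sum.mono_neutral_cong_left) auto
      finally show ?thesis .
    qed
    have "(\<Sum>k<N. (of_int m gchoose k) *s (\<Sum>s<N. (of_int (l + int k + 1) gchoose s) *s
        zhu_prod (zhu_prod u (l + int k) v) (m + n - int k + int s) w))
      = (\<Sum>k<N. \<Sum>i<N. ((of_int m gchoose k) * (\<alpha> gchoose i)) *s
          (\<Sum>E<N. (if i \<le> E then (\<alpha> + \<beta> - of_nat i) gchoose (E - i) else 0) *s G (k + i) E))"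
    proof (rule sum.cong[OF refl])
      fix k
      have "zhu_prod u (l + int k) v = (\<Sum>i<N. (\<alpha> gchoose i) *s Y u (l + int k + int i) v)"
      proof (rule u_mode)
        fix i assume "N \<le> i"
        then show "Y u (l + int k + int i) v = 0" using N2[of "k + i"] N by (simp add: add_ac)
      qed
      then have "(\<Sum>s<N. (of_int (l + int k + 1) gchoose s) *s
          zhu_prod (zhu_prod u (l + int k) v) (m + n - int k + int s) w)
        = (\<Sum>i<N. (\<alpha> gchoose i) *s (\<Sum>s<N. (of_int (l + int k + 1) gchoose s) *s
          zhu_prod (Y u (l + int k + int i) v) (m + n - int k + int s) w))"
        by (simp only: zhu_prod_sum_left zhu_prod_scale_left scale_sum_right scale_scale mult.commute)
          (rule sum.swap)
      then show "(of_int m gchoose k) *s (\<Sum>s<N. (of_int (l + int k + 1) gchoose s) *s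
          zhu_prod (zhu_prod u (l + int k) v) (m + n - int k + int s) w)
        = (\<Sum>i<N. ((of_int m gchoose k) * (\<alpha> gchoose i)) *s
          (\<Sum>E<N. (if i \<le> E then (\<alpha> + \<beta> - of_nat i) gchoose (E - i) else 0) *s G (k + i) E))"
        by (simp only: inner scale_sum_right scale_scale mult.assoc)
    qed
    also have "\<dots> = (\<Sum>i<N. \<Sum>k<N. ((of_int m gchoose k) * (\<alpha> gchoose i)) *s
          (\<Sum>E<N. (if i \<le> E then (\<alpha> + \<beta> - of_nat i) gchoose (E - i) else 0) *s G (k + i) E))"
      by (rule sum.swap)
    also have "\<dots> = (\<Sum>K<N. \<Sum>i\<le>K. ((of_int m gchoose (K - i)) * (\<alpha> gchoose i)) *s
          (\<Sum>E<N. (if i \<le> E then (\<alpha> + \<beta> - of_nat i) gchoose (E - i) else 0) *s G K E))"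
      by (subst sum_square_eq_triangle) (auto simp: G0 add.commute intro!: sum.neutral)
    also have "\<dots> = (\<Sum>K<N. \<Sum>E<N. (\<Sum>i\<le>K. if i \<le> E then (of_int m gchoose (K - i)) * (\<alpha> gchoose i) *
        ((\<alpha> + \<beta> - of_nat i) gchoose (E - i)) else 0) *s G K E)"
      unfolding scale_sum_right scale_sum_left
      by (rule sum.cong[OF refl], subst sum.swap) (auto intro!: sum.cong)
    finally show ?case unfolding lhs[unfolded \<epsilon>_def] by (rule sym)
  qed
qed

lemma zhu_prod_jacobi:
  assumes "u \<in> deg p" "v \<in> deg q"
  shows "\<forall>\<^sub>F N in sequentially.
    (\<Sum>i<N. ((-1) ^ i * (of_int l gchoose i)) *s
        (zhu_prod u (m + l - int i) (zhu_prod v (n + int i) w)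
          - ((-1) powi l * (-1) powi (p * q)) *s
            zhu_prod v (n + l - int i) (zhu_prod u (m + int i) w)))
    = (\<Sum>k<N. (of_int m gchoose k) *s (\<Sum>s<N. (of_int (l + int k + 1) gchoose s) *s
        zhu_prod (zhu_prod u (l + int k) v) (m + n - int k + int s) w))"
proof -
  define L where "L N u v = (\<Sum>i<N. ((-1) ^ i * (of_int l gchoose i)) *s
        (zhu_prod u (m + l - int i) (zhu_prod v (n + int i) w)
          - ((-1) powi l * (-1) powi (p * q)) *s
            zhu_prod v (n + l - int i) (zhu_prod u (m + int i) w)))" for N u v
  define R where "R N u v = (\<Sum>k<N. (of_int m gchoose k) *s (\<Sum>s<N. (of_int (l + int k + 1) gchoose s) *s
        zhu_prod (zhu_prod u (l + int k) v) (m + n - int k + int s) w))" for N u v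
  have L_add: "L N (u + u') v = L N u v + L N u' v" "L N u (v + v') = L N u v + L N u v'" for N u u' v v'
    unfolding L_def sum.distrib[symmetric]
    by (intro sum.cong refl; simp add: zhu_prod_add_left zhu_prod_add_right scale_right_distrib
        scale_right_diff_distrib)+
  have R_add: "R N (u + u') v = R N u v + R N u' v" "R N u (v + v') = R N u v + R N u v'" for N u u' v v'
    unfolding R_def
    by (simp_all add: zhu_prod_add_left zhu_prod_add_right scale_right_distrib sum.distrib)
  from assms(1) have "\<forall>\<^sub>F N in sequentially. L N u v = R N u v"
  proof (induction u rule: bihomogeneous_induct)
    case (homogeneous a u)
    note u = homogeneous
    from assms(2) show ?case
    proof (induction v rule: bihomogeneous_induct)
      case (homogeneous b v)
      show ?case
        unfolding L_def R_def
        by (rule zhu_prod_jacobi_bihomogeneous[OF u(1) homogeneous(1) u(2) homogeneous(2)])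
    next
      case (add v v')
      then show ?case by eventually_elim (simp add: L_add R_add)
    qed
  next
    case (add u u')
    then show ?case by eventually_elim (simp add: L_add R_add)
  qed
  then show ?thesis unfolding L_def R_def .
qed

sublocale zhu: deformed_vertex_algebra scale deg 1 zhu_prod vac
  using zhu_prod_jacobi
  by unfold_locales
    (auto simp: zhu_prod_add_left zhu_prod_add_right zhu_prod_scale_left zhu_prod_scale_right
      zhu_prod_truncation vac_degree zhu_prod_vacuum zhu_prod_creation_regular
      zhu_prod_creation_constant)

lemma zhu_O_eq: "zhu_O = zhu.J"
  by (simp add: zhu_O_def zhu.J_def zhu_circ_eq)

section \<open>The degree filtration\<close>

text \<open>
  Described by components, which is the form in which membership is checked; \<open>Filt_eq_span\<close> relates it
  to the sum of the spaces of degree at most \<open>p\<close>.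
\<close>

definition Filt :: "int \<Rightarrow> 'v set" where
  "Filt p = {v. \<forall>q>p. component deg v q = 0}"

lemma subspace_Filt: "subspace (Filt p)"
  by (auto simp: subspace_def Filt_def degree.component_0 degree.component_add degree.component_scale)

lemma Filt_mono: "p \<le> q \<Longrightarrow> Filt p \<subseteq> Filt q"
  by (auto simp: Filt_def)

lemma deg_subset_Filt: "p \<le> q \<Longrightarrow> deg p \<subseteq> Filt q"
  by (auto simp: Filt_def degree.component_homogeneous)

lemma Filt_induct [consumes 1, case_names homogeneous add]:
  assumes v: "v \<in> Filt p"
    and hom: "\<And>q v. q \<le> p \<Longrightarrow> v \<in> deg q \<Longrightarrow> Q v"
    and add: "\<And>v w. Q v \<Longrightarrow> Q w \<Longrightarrow> Q (v + w)"
  shows "Q v"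
proof -
  have "Q (\<Sum>q\<in>A. component deg v q)" if "finite A" "A \<subseteq> {..p}" for A
    using that
  proof induction
    case empty
    then show ?case using hom[of p 0] by (simp add: subspace_0 deg_subspace)
  qed (auto intro: add hom degree.component_in)
  from this[OF degree.finite_component[of v]] v show ?thesis
    by (auto simp: degree.sum_component Filt_def not_le[symmetric])
qed

lemma Filt_eq_span: "Filt p = span (\<Union>q\<in>{..p}. deg q)"
proof
  show "Filt p \<subseteq> span (\<Union>q\<in>{..p}. deg q)"
  proof
    fix v assume "v \<in> Filt p"
    then show "v \<in> span (\<Union>q\<in>{..p}. deg q)"
      by (induction rule: Filt_induct) (auto intro: span_base span_add)
  qed
  show "span (\<Union>q\<in>{..p}. deg q) \<subseteq> Filt p"
    by (rule span_minimal) (auto intro: subsetD[OF deg_subset_Filt] subspace_Filt)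
qed

text \<open>
  The summand \<open>u\<^bsub>m+i\<^esub> v\<close> of the deformed product has degree \<open>p + q - 2 m - 2 - 2 i\<close>, so everything beyond
  the undeformed product \<open>i = 0\<close> lies two steps lower.
\<close>

lemma zhu_prod_degree:
  assumes "u \<in> deg p" "v \<in> deg q"
  shows "zhu_prod u m v \<in> Filt (p + q - 2 * m - 2)"
    and "zhu_prod u m v - Y u m v \<in> Filt (p + q - 2 * m - 4)"
proof -
  have *: "zhu_prod u m v \<in> Filt (p + q - 2 * m - 2) \<and> zhu_prod u m v - Y u m v \<in> Filt (p + q - 2 * m - 4)"
    using assms(1)
  proof (induction u rule: bihomogeneous_induct)
    case (homogeneous k u)
    have "\<forall>\<^sub>F N in sequentially. zhu_prod u m v \<in> Filt (p + q - 2 * m - 2)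
       \<and> zhu_prod u m v - Y u m v \<in> Filt (p + q - 2 * m - 4)"
      using eventually_mode_sum[of "of_int k / 2" u m v] eventually_gt_at_top[of 0]
    proof eventually_elim
      case (elim N)
      then obtain N' where N': "N = Suc N'" using gr0_implies_Suc by blast
      define f where "f i = (of_int k / 2 gchoose i) *s Y u (m + int i) v" for i
      have f: "f i \<in> Filt r" if "p + q - 2 * m - 2 * int i - 2 \<le> r" for i r
      proof -
        have "Y u (m + int i) v \<in> Filt r"
          by (rule subsetD[OF deg_subset_Filt Y_degree[OF homogeneous(1) assms(2)]]) (use that in auto)
        then show ?thesis unfolding f_def by (rule subspace_scale[OF subspace_Filt])
      qed
      have sum: "zhu_prod u m v = sum f {..<N}"
        unfolding zhu_prod_homogeneous[OF homogeneous(2)] f_def by (rule elim)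
      then have "zhu_prod u m v \<in> Filt (p + q - 2 * m - 2)"
        by (simp add: subspace_sum[OF subspace_Filt] f)
      moreover have "zhu_prod u m v - Y u m v = (\<Sum>i<N'. f (Suc i))"
        unfolding sum N' sum.lessThan_Suc_shift by (simp add: f_def)
      then have "zhu_prod u m v - Y u m v \<in> Filt (p + q - 2 * m - 4)"
        by (simp add: subspace_sum[OF subspace_Filt] f)
      ultimately show ?case by blast
    qed
    then show ?case by (simp add: eventually_const_iff)
  next
    case (add u u')
    then show ?case
      using subspace_add[OF subspace_Filt, of "zhu_prod u m v" _ "zhu_prod u' m v"]
        subspace_add[OF subspace_Filt, of "zhu_prod u m v - Y u m v" _ "zhu_prod u' m v - Y u' m v"]
      by (auto simp: zhu_prod_add_left undeformed.P_add_left algebra_simps)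
  qed
  show "zhu_prod u m v \<in> Filt (p + q - 2 * m - 2)"
    "zhu_prod u m v - Y u m v \<in> Filt (p + q - 2 * m - 4)" using * by auto
qed

lemma zhu_prod_Filt:
  assumes "u \<in> Filt p" "v \<in> Filt q"
  shows "zhu_prod u m v \<in> Filt (p + q - 2 * m - 2)"
  using assms(1)
proof (induction u rule: Filt_induct)
  case (homogeneous p' u)
  note u = homogeneous
  from assms(2) show ?case
  proof (induction v rule: Filt_induct)
    case (homogeneous q' v)
    show ?case
      by (rule subsetD[OF Filt_mono zhu_prod_degree(1)[OF u(2) homogeneous(2)]])
        (use u(1) homogeneous(1) in auto)
  qed (simp add: zhu_prod_add_right subspace_add[OF subspace_Filt])
qed (simp add: zhu_prod_add_left subspace_add[OF subspace_Filt])

lemma d_Filt: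
  assumes "u \<in> Filt p"
  shows "d u \<in> Filt (p + 1)"
  using assms
proof (induction rule: Filt_induct)
  case (homogeneous q v)
  then show ?case by (intro subsetD[OF deg_subset_Filt d_degree[of v q]]) auto
qed (simp add: d_add subspace_add[OF subspace_Filt])

lemma d_zhu_prod:
  assumes "u \<in> deg p"
  shows "d (zhu_prod u m v) = zhu_prod (d u) m v + ((-1) powi p) *s zhu_prod u m (d v)"
  using assms
proof (induction u rule: bihomogeneous_induct)
  case (homogeneous k u)
  have "\<forall>\<^sub>F N in sequentially.
    d (zhu_prod u m v) = zhu_prod (d u) m v + ((-1) powi p) *s zhu_prod u m (d v)"
    using eventually_mode_sum[of "of_int k / 2" u m v] eventually_mode_sum[of "of_int k / 2" "d u" m v]
      eventually_mode_sum[of "of_int k / 2" u m "d v"]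
  proof eventually_elim
    case (elim N)
    show ?case
      unfolding zhu_prod_homogeneous[OF homogeneous(2)] zhu_prod_homogeneous[OF d_weight[OF homogeneous(2)]]
        elim
      by (simp add: d_sum d_scale d_Y[OF homogeneous(1)] scale_right_distrib sum.distrib scale_sum_right
          mult.commute)
  qed
  then show ?case by (simp add: eventually_const_iff)
qed (simp add: d_add zhu_prod_add_left scale_right_distrib)

lemma d_zhu_O:
  assumes "x \<in> zhu_O"
  shows "d x \<in> zhu_O"
  using assms unfolding zhu_O_eq
proof (induction x rule: zhu.J_induct)
  case (generator p q u v)
  show ?case unfolding d_zhu_prod[OF generator(1)]
    by (intro zhu.J_add zhu.J_scale zhu.P_minus_two_in_J)
qed (auto simp: d_add d_scale zhu.J_add zhu.J_scale)

text \<open>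
  The preimage in \<open>V\<close> of the filtration step \<open>F\<^sup>p A(V)\<close>. Classes in \<open>gr\<^sup>p A(V)\<close> of vectors in \<open>Filt p\<close> agree
  exactly when the vectors differ by an element of \<open>O_Filt (p - 1)\<close>.
\<close>

definition O_Filt :: "int \<Rightarrow> 'v set" where
  "O_Filt p = {x + y |x y. x \<in> zhu_O \<and> y \<in> Filt p}"

lemma subspace_O_Filt: "subspace (O_Filt p)"
  unfolding O_Filt_def zhu_O_def by (rule subspace_sums[OF subspace_span subspace_Filt])

lemma zhu_O_subset_O_Filt: "zhu_O \<subseteq> O_Filt p"
  using subspace_0[OF subspace_Filt] unfolding O_Filt_def by force

lemma Filt_subset_O_Filt: "p \<le> q \<Longrightarrow> Filt p \<subseteq> O_Filt q"
  using subspace_0[OF zhu.subspace_J] Filt_mono[of p q] unfolding O_Filt_def zhu_O_eq by force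

lemma zhu_mult_O_Filt_left:
  assumes "u \<in> O_Filt p" "v \<in> Filt q"
  shows "zhu_mult u v \<in> O_Filt (p + q)"
proof -
  obtain x y where xy: "u = x + y" "x \<in> zhu_O" "y \<in> Filt p" using assms(1) by (auto simp: O_Filt_def)
  have "zhu_mult x v \<in> zhu_O" using zhu.J_right_ideal xy(2) by (simp add: zhu_mult_eq zhu_O_eq)
  moreover have "zhu_mult y v \<in> Filt (p + q)"
    using zhu_prod_Filt[OF xy(3) assms(2), of "-1"] by (simp add: zhu_mult_eq)
  ultimately show ?thesis by (auto simp: O_Filt_def xy zhu_mult_eq zhu_prod_add_left)
qed

lemma zhu_mult_O_Filt_right:
  assumes "u \<in> Filt p" "v \<in> O_Filt q"
  shows "zhu_mult u v \<in> O_Filt (p + q)"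
proof -
  obtain x y where xy: "v = x + y" "x \<in> zhu_O" "y \<in> Filt q" using assms(2) by (auto simp: O_Filt_def)
  have "zhu_mult u x \<in> zhu_O" using zhu.J_left_ideal xy(2) by (simp add: zhu_mult_eq zhu_O_eq)
  moreover have "zhu_mult u y \<in> Filt (p + q)"
    using zhu_prod_Filt[OF assms(1) xy(3), of "-1"] by (simp add: zhu_mult_eq)
  ultimately show ?thesis by (auto simp: O_Filt_def xy zhu_mult_eq zhu_prod_add_right)
qed

text \<open>
  The reason why \<open>\<eta>\<close> is well defined: \<open>u\<^bsub>-2\<^esub> v\<close> is homogeneous and is the leading term of the element
  \<open>u \<circ> v\<close> of \<open>O(V)\<close>.
\<close>

lemma C2_component_O_Filt:
  assumes "u \<in> C2"
  shows "component deg u p \<in> O_Filt (p - 1)"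
  using assms unfolding C2_eq
proof (induction u rule: undeformed.J_induct)
  case (generator q r u v)
  have "Y u (-2) v \<in> O_Filt (q + r + 1)"
  proof -
    have "zhu_prod u (-2) v \<in> O_Filt (q + r + 1)"
      using zhu.P_minus_two_in_J zhu_O_subset_O_Filt unfolding zhu_O_eq by blast
    moreover have "zhu_prod u (-2) v - Y u (-2) v \<in> O_Filt (q + r + 1)"
      using zhu_prod_degree(2)[OF generator, of "-2"] Filt_subset_O_Filt[of "q + r" "q + r + 1"] by auto
    ultimately show ?thesis
      using subspace_diff[OF subspace_O_Filt] by fastforce
  qed
  moreover have "Y u (-2) v \<in> deg (q + r + 2)"
    using Y_degree[OF generator, of "-2"] by (simp add: algebra_simps)
  ultimately show ?case
    by (auto simp: degree.component_homogeneous subspace_0[OF subspace_O_Filt] add_ac)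
qed (auto simp: degree.component_add degree.component_scale subspace_add[OF subspace_O_Filt]
    subspace_scale[OF subspace_O_Filt])

section \<open>The supercommutator\<close>

text \<open>
  The linear operator that provides the sign of exchanging \<open>u\<close> with a vector of degree \<open>q\<close> also when
  \<open>u\<close> is not homogeneous.
\<close>

definition twist :: "int \<Rightarrow> 'v \<Rightarrow> 'v" where
  "twist q u = (\<Sum>p | component deg u p \<noteq> 0. ((-1) powi (p * q)) *s component deg u p)"

lemma twist_eq_sum:
  assumes "finite A" "{p. component deg u p \<noteq> 0} \<subseteq> A"
  shows "twist q u = (\<Sum>p\<in>A. ((-1) powi (p * q)) *s component deg u p)"
  unfolding twist_def by (rule sum.mono_neutral_left) (use assms in auto)

lemma twist_homogeneous:
  assumes "u \<in> deg p"
  shows "twist q u = ((-1) powi (p * q)) *s u"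
proof -
  have "{r. component deg u r \<noteq> 0} \<subseteq> {p}"
    by (auto simp: degree.component_homogeneous[OF assms] split: if_splits)
  from twist_eq_sum[OF _ this] show ?thesis
    by (simp add: degree.component_homogeneous[OF assms])
qed

lemma twist_add: "twist q (u + v) = twist q u + twist q v"
proof -
  define A where "A = {k. component deg u k \<noteq> 0} \<union> {k. component deg v k \<noteq> 0}"
  have A: "finite A" "{k. component deg u k \<noteq> 0} \<subseteq> A"
    "{k. component deg v k \<noteq> 0} \<subseteq> A" "{k. component deg (u + v) k \<noteq> 0} \<subseteq> A"
    by (auto simp: A_def degree.finite_component degree.component_add)
  show ?thesis
    unfolding twist_eq_sum[OF A(1,2)] twist_eq_sum[OF A(1,3)] twist_eq_sum[OF A(1,4)]
    by (simp add: degree.component_add scale_right_distrib sum.distrib)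
qed

lemma twist_scale: "twist q (c *s u) = c *s twist q u"
proof -
  have "{k. component deg (c *s u) k \<noteq> 0} \<subseteq> {k. component deg u k \<noteq> 0}"
    by (auto simp: degree.component_scale)
  from twist_eq_sum[OF degree.finite_component this, of q] show ?thesis
    by (simp add: twist_def degree.component_scale scale_sum_right mult.commute)
qed

lemma twist_sum: "twist q (sum f A) = (\<Sum>a\<in>A. twist q (f a))"
  using twist_scale[of q 0 0]
  by (induction A rule: infinite_finite_induct) (auto simp: twist_add)

text \<open>
  All components of the deformed product have degrees congruent to \<open>p + r\<close> modulo two, so \<open>twist\<close> acts on
  it by a scalar and therefore preserves \<open>O(V)\<close>.
\<close>

lemma twist_zhu_prod:
  assumes "u \<in> deg p" "v \<in> deg r"
  shows "twist q (zhu_prod u m v) = ((-1) powi ((p + r) * q)) *s zhu_prod u m v"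
  using assms(1)
proof (induction u rule: bihomogeneous_induct)
  case (homogeneous k u)
  have "\<forall>\<^sub>F N in sequentially. twist q (zhu_prod u m v) = ((-1) powi ((p + r) * q)) *s zhu_prod u m v"
    using eventually_mode_sum[of "of_int k / 2" u m v]
  proof eventually_elim
    case (elim N)
    have "twist q (Y u (m + int i) v) = ((-1) powi ((p + r) * q)) *s Y u (m + int i) v" for i
      unfolding twist_homogeneous[OF Y_degree[OF homogeneous(1) assms(2)]]
      by (rule arg_cong[where f = "\<lambda>c. c *s _"]) (auto simp: power_int_minus_left)
    then show ?case
      unfolding zhu_prod_homogeneous[OF homogeneous(2)] elim
      by (simp add: twist_sum twist_scale scale_sum_right mult.commute)
  qed
  then show ?case by (simp add: eventually_const_iff)
qed (simp add: twist_add zhu_prod_add_left scale_right_distrib)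

lemma twist_zhu_O:
  assumes "x \<in> zhu_O"
  shows "twist q x \<in> zhu_O"
  using assms unfolding zhu_O_eq
  by (induction x rule: zhu.J_induct)
    (auto simp: twist_zhu_prod twist_add twist_scale intro: zhu.J_add zhu.J_scale zhu.P_minus_two_in_J)

text \<open>
  Linear in \<open>u\<close>; the degree \<open>q\<close> is meant to be that of \<open>v\<close>.
\<close>

definition supercommutator :: "int \<Rightarrow> 'v \<Rightarrow> 'v \<Rightarrow> 'v" where
  "supercommutator q u v = zhu_mult u v - zhu_mult v (twist q u)"

lemma supercommutator_homogeneous:
  assumes "u \<in> deg p"
  shows "supercommutator q u v = zhu_mult u v - ((-1) powi (p * q)) *s zhu_mult v u"
  by (simp add: supercommutator_def twist_homogeneous[OF assms] zhu_mult_eq zhu_prod_scale_right)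

lemma supercommutator_add: "supercommutator q (u + u') v = supercommutator q u v + supercommutator q u' v"
  by (simp add: supercommutator_def twist_add zhu_mult_eq zhu_prod_add_left zhu_prod_add_right)

text \<open>
  The products \<open>u\<^sub>k v\<close> with \<open>k > 0\<close> have degree at most \<open>p + q - 4\<close>, so modulo \<open>F\<^bsup>p+q-3\<^esup> A(V)\<close> only \<open>u\<^sub>0 v\<close> is
  left of the supercommutator.
\<close>

lemma supercommutator_leading:
  assumes "u \<in> deg p" "v \<in> deg q"
  shows "supercommutator q u v - Y u 0 v \<in> O_Filt (p + q - 3)"
proof -
  have "zhu_prod u (-1) v - ((-1) powi (p * q)) *s zhu_prod v (-1) u - 1 *s zhu_prod u 0 v
      \<in> O_Filt (p + q - 3)"
  proof (rule zhu.supercommutator_mod_J[OF assms subspace_O_Filt])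
    show "zhu.J \<subseteq> O_Filt (p + q - 3)" using zhu_O_subset_O_Filt by (simp add: zhu_O_eq)
    fix k :: int assume "k > 0"
    then show "zhu_prod u k v \<in> O_Filt (p + q - 3)"
      by (intro subsetD[OF Filt_subset_O_Filt zhu_prod_degree(1)[OF assms]]) auto
  qed
  moreover have "zhu_prod u 0 v - Y u 0 v \<in> O_Filt (p + q - 3)"
    by (rule subsetD[OF Filt_subset_O_Filt zhu_prod_degree(2)[OF assms]]) auto
  ultimately show ?thesis
    using subspace_add[OF subspace_O_Filt] unfolding supercommutator_homogeneous[OF assms(1)] zhu_mult_eq
    by fastforce
qed

text \<open>
  The supercommutator maps the part of \<open>u\<close> in \<open>O(V)\<close> to \<open>O(V)\<close>, an ideal preserved by \<open>twist\<close>. On the rest it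
  lowers the degree by two, applied to each component separately. This is what makes the bracket
  of \<open>gr A(V)\<close> independent of representatives.
\<close>

lemma supercommutator_O_Filt:
  assumes "u \<in> O_Filt (p - 1)" "v \<in> deg q"
  shows "supercommutator q u v \<in> O_Filt (p + q - 3)"
proof -
  obtain x y where xy: "u = x + y" "x \<in> zhu_O" "y \<in> Filt (p - 1)" using assms(1) by (auto simp: O_Filt_def)
  have "supercommutator q x v \<in> zhu_O"
    unfolding supercommutator_def zhu_mult_eq zhu_O_eq
    using xy(2) twist_zhu_O[OF xy(2)]
    by (intro zhu.J_diff zhu.J_right_ideal zhu.J_left_ideal) (auto simp: zhu_O_eq)
  moreover from xy(3) have "supercommutator q y v \<in> O_Filt (p + q - 3)"
  proof (induction y rule: Filt_induct)
    case (homogeneous r y)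
    have "supercommutator q y v - Y y 0 v \<in> O_Filt (p + q - 3)"
      using supercommutator_leading[OF homogeneous(2) assms(2)] homogeneous(1) O_Filt_def
        Filt_mono[of "r + q - 3" "p + q - 3"] by fastforce
    moreover have "Y y 0 v \<in> O_Filt (p + q - 3)"
      by (rule subsetD[OF Filt_subset_O_Filt[OF order_refl]],
          rule subsetD[OF deg_subset_Filt Y_degree[OF homogeneous(2) assms(2)]])
        (use homogeneous(1) in auto)
    ultimately show ?case using subspace_add[OF subspace_O_Filt] by fastforce
  qed (simp add: supercommutator_add subspace_add[OF subspace_O_Filt])
  ultimately show ?thesis
    using zhu_O_subset_O_Filt by (auto simp: xy(1) supercommutator_add intro: subspace_add[OF subspace_O_Filt])
qed

end

section \<open>Cosets and the algebra R(V)\<close>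

lemma (in vector_space) subspace_plus_self:
  assumes S: "subspace S"
  shows "S + S = S"
proof
  show "S + S \<subseteq> S" using subspace_add[OF S] by (auto elim!: set_plus_elim)
  show "S \<subseteq> S + S" using subspace_0[OF S] by (rule set_zero_plus2)
qed

lemma (in vector_space) coset_plus: "subspace S \<Longrightarrow> (u +o S) + (v +o S) = (u + v) +o S"
  by (simp add: set_plus_rearrange subspace_plus_self)

lemma (in vector_space) coset_eq_iff:
  assumes S: "subspace S"
  shows "u +o S = v +o S \<longleftrightarrow> u - v \<in> S"
proof
  assume "u +o S = v +o S"
  moreover have "u \<in> u +o S" using subspace_0[OF S] set_plus_intro2[of 0 S u] by simp
  ultimately show "u - v \<in> S" by (simp add: set_plus_imp_minus)
next
  assume uv: "u - v \<in> S"
  have "x - u \<in> S \<longleftrightarrow> x - v \<in> S" for x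
    using subspace_add[OF S uv, of "x - u"] subspace_diff[OF S _ uv, of "x - v"] by auto
  then have "x \<in> u +o S \<longleftrightarrow> x \<in> v +o S" for x
    unfolding set_minus_plus[symmetric] .
  then show "u +o S = v +o S" by blast
qed

lemma (in vector_space) UN_coset:
  assumes "subspace S" "\<And>x. x - u \<in> S \<Longrightarrow> F x = F u"
  shows "(\<Union>x\<in>u +o S. F x) = F u"
proof (rule SUP_eq_const)
  show "u +o S \<noteq> {}" using subspace_0[OF assms(1)] set_plus_intro2[of 0 S u] by auto
  show "F x = F u" if "x \<in> u +o S" for x
    using set_plus_imp_minus[OF that] by (rule assms(2))
qed

context dg_vertex_algebra
begin

lemma subspace_C2: "subspace C2"
  by (simp add: C2_def)

lemma R_class_eq_iff: "R_class u = R_class v \<longleftrightarrow> u - v \<in> C2"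
  unfolding R_class_def by (rule coset_eq_iff[OF subspace_C2])

lemma UN_R_class:
  assumes "\<And>x. x - u \<in> C2 \<Longrightarrow> F x = F u"
  shows "(\<Union>x\<in>R_class u. F x) = F u"
  unfolding R_class_def by (rule UN_coset[OF subspace_C2]) (rule assms)

lemma UN_R_class2:
  assumes "\<And>x. x \<in> C2 \<Longrightarrow> Y x n v \<in> C2" "\<And>u x. x \<in> C2 \<Longrightarrow> Y u n x \<in> C2"
  shows "(\<Union>x\<in>R_class u. \<Union>y\<in>R_class v. R_class (Y x n y)) = R_class (Y u n v)"
proof -
  have "(\<Union>y\<in>R_class v. R_class (Y x n y)) = R_class (Y x n v)" for x
    by (rule UN_R_class) (simp add: R_class_eq_iff assms(2) flip: undeformed.P_diff_right)
  then have "(\<Union>x\<in>R_class u. \<Union>y\<in>R_class v. R_class (Y x n y)) = (\<Union>x\<in>R_class u. R_class (Y x n v))"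
    by simp
  also have "\<dots> = R_class (Y u n v)"
    by (rule UN_R_class) (simp add: R_class_eq_iff assms(1) flip: undeformed.P_diff_left)
  finally show ?thesis .
qed

lemma d_diff: "d (u - v) = d u - d v"
  using d_add[of "u - v" v] by simp

lemma poisson_quotient_R: "poisson_quotient scale deg d Y vac R_algebra R_class"
proof unfold_locales
  fix u v :: 'v and c :: complex and p :: int
  show "R_class u \<oplus>\<^bsub>R_algebra\<^esub> R_class v = R_class (u + v)"
    by (simp add: R_algebra_def R_class_def coset_plus[OF subspace_C2])
  show "R_class u \<otimes>\<^bsub>R_algebra\<^esub> R_class v = R_class (Y u (-1) v)"
    by (simp add: R_algebra_def UN_R_class2 undeformed.J_left_ideal[folded C2_eq]
        undeformed.J_right_ideal[folded C2_eq])
  show "c \<odot>\<^bsub>R_algebra\<^esub> R_class u = R_class (c *s u)"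
    by (simp add: R_algebra_def UN_R_class R_class_eq_iff subspace_scale[OF subspace_C2]
        flip: scale_right_diff_distrib)
  show "dgdiff R_algebra (R_class u) = R_class (d u)"
    by (simp add: R_algebra_def UN_R_class R_class_eq_iff d_C2 flip: d_diff)
  show "pbracket R_algebra (R_class u) (R_class v) = R_class (Y u 0 v)"
    by (simp add: R_algebra_def UN_R_class2 zero_mode_C2_left zero_mode_C2_right)
  have zero: "\<zero>\<^bsub>R_algebra\<^esub> = R_class 0" by (simp add: R_algebra_def R_class_def)
  show "\<zero>\<^bsub>R_algebra\<^esub> = R_class 0" by (rule zero)
  show "R_class u = \<zero>\<^bsub>R_algebra\<^esub>" if "u \<in> C2"
    using that by (simp add: zero R_class_eq_iff)
  show "R_class (component deg u p) = \<zero>\<^bsub>R_algebra\<^esub>" if "R_class u = \<zero>\<^bsub>R_algebra\<^esub>"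
    using that by (simp add: zero R_class_eq_iff component_C2)
qed (simp_all add: R_algebra_def)

lemma Y_sum_left: "Y (sum f A) n w = (\<Sum>a\<in>A. Y (f a) n w)"
  by (induction A rule: infinite_finite_induct) (auto simp: undeformed.P_zero_left undeformed.P_add_left)

lemma component_Y:
  "component deg (Y u n v) r = (\<Sum>p | component deg u p \<noteq> 0.
    Y (component deg u p) n (component deg v (r + 2 * n + 2 - p)))"
proof -
  have *: "component deg (Y x n v) r = Y x n (component deg v (r + 2 * n + 2 - p))" if "x \<in> deg p" for x p
  proof (induction v rule: degree.homogeneous_induct)
    case (homogeneous q v)
    show ?case
      by (auto simp: degree.component_homogeneous[OF Y_degree[OF that homogeneous]]
          degree.component_homogeneous[OF homogeneous] undeformed.P_zero_right)
  qed (simp add: degree.component_add undeformed.P_add_right)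
  have "component deg (Y u n v) r = component deg (Y (\<Sum>p | component deg u p \<noteq> 0. component deg u p) n v) r"
    by (simp add: degree.sum_component)
  then show ?thesis
    by (simp add: Y_sum_left degree.component_sum *[OF degree.component_in])
qed

lemma component_d: "component deg (d u) (p + 1) = d (component deg u p)"
proof (induction u rule: degree.homogeneous_induct)
  case (homogeneous q u)
  show ?case
    using d_scale[of 0 0]
    by (auto simp: degree.component_homogeneous[OF homogeneous]
        degree.component_homogeneous[OF d_degree[OF homogeneous]])
qed (simp add: degree.component_add d_add)

end

section \<open>The associated graded of the Zhu algebra\<close>

context dg_vertex_operator_algebra
begin

lemma subspace_zhu_O: "subspace zhu_O"
  by (simp add: zhu_O_def)

lemma A_class_eq_iff: "A_class u = A_class v \<longleftrightarrow> u - v \<in> zhu_O"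
  unfolding A_class_def by (rule coset_eq_iff[OF subspace_zhu_O])

lemma A_class_plus: "A_class u + A_class v = A_class (u + v)"
  unfolding A_class_def by (rule coset_plus[OF subspace_zhu_O])

lemma UN_A_class:
  assumes "\<And>x. x - u \<in> zhu_O \<Longrightarrow> F x = F u"
  shows "(\<Union>x\<in>A_class u. F x) = F u"
  unfolding A_class_def by (rule UN_coset[OF subspace_zhu_O]) (rule assms)

lemma A_mult_class: "A_mult (A_class u) (A_class v) = A_class (zhu_mult u v)"
proof -
  have "(\<Union>y\<in>A_class v. A_class (zhu_mult x y)) = A_class (zhu_mult x v)" for x
    using zhu.J_left_ideal
    by (intro UN_A_class) (simp add: A_class_eq_iff zhu_mult_eq zhu_O_eq flip: zhu.P_diff_right)
  then have "A_mult (A_class u) (A_class v) = (\<Union>x\<in>A_class u. A_class (zhu_mult x v))"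
    by (simp add: A_mult_def)
  also have "\<dots> = A_class (zhu_mult u v)"
    using zhu.J_right_ideal
    by (intro UN_A_class) (simp add: A_class_eq_iff zhu_mult_eq zhu_O_eq flip: zhu.P_diff_left)
  finally show ?thesis .
qed

lemma A_smult_class: "A_smult c (A_class u) = A_class (c *s u)"
  unfolding A_smult_def
  by (rule UN_A_class)
    (simp add: A_class_eq_iff subspace_scale[OF subspace_zhu_O] flip: scale_right_diff_distrib)

lemma A_diff_class: "A_diff (A_class u) = A_class (d u)"
  unfolding A_diff_def by (rule UN_A_class) (simp add: A_class_eq_iff d_zhu_O flip: d_diff)

lemma A_filt_eq: "A_filt p = A_class ` Filt p"
  by (simp add: A_filt_def Filt_eq_span)

lemma A_class_plus_A_filt: "A_class u +o A_filt p = A_class ` (u +o Filt p)"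
  by (auto simp: A_filt_eq elt_set_plus_def A_class_plus)

lemma gr_class_eq_image: "gr_class p u = A_class ` (u +o Filt (p - 1))"
  by (simp add: gr_class_def A_class_plus_A_filt)

lemma gr_class_eq_iff: "gr_class p u = gr_class p v \<longleftrightarrow> u - v \<in> O_Filt (p - 1)"
proof
  assume "gr_class p u = gr_class p v"
  moreover have "A_class u \<in> gr_class p u"
    unfolding gr_class_eq_image
    using subspace_0[OF subspace_Filt] set_plus_intro2[of 0 "Filt (p - 1)" u] by auto
  ultimately obtain y where "y \<in> Filt (p - 1)" "A_class u = A_class (v + y)"
    unfolding gr_class_eq_image elt_set_plus_def by auto
  moreover have "u - v = (u - (v + y)) + y" by simp
  ultimately show "u - v \<in> O_Filt (p - 1)"
    unfolding O_Filt_def A_class_eq_iff by blast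
next
  have *: "gr_class p u \<subseteq> gr_class p v" if uv: "u - v \<in> O_Filt (p - 1)" for u v
  proof
    obtain x y where xy: "u - v = x + y" "x \<in> zhu_O" "y \<in> Filt (p - 1)"
      using uv by (auto simp: O_Filt_def)
    fix a assume "a \<in> gr_class p u"
    then obtain f where f: "f \<in> Filt (p - 1)" "a = A_class (u + f)"
      unfolding gr_class_eq_image elt_set_plus_def by auto
    have "(u + f) - (v + (y + f)) = x" using xy(1) by (simp add: algebra_simps)
    then have "a = A_class (v + (y + f))" using f xy(2) by (simp add: A_class_eq_iff)
    then show "a \<in> gr_class p v"
      using subspace_add[OF subspace_Filt xy(3) f(1)]
      unfolding gr_class_eq_image elt_set_plus_def by auto
  qed
  assume "u - v \<in> O_Filt (p - 1)"
  moreover from this have "v - u \<in> O_Filt (p - 1)"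
    using subspace_neg[OF subspace_O_Filt] by fastforce
  ultimately show "gr_class p u = gr_class p v" using * by blast
qed

lemma gr_class_plus: "gr_class p u + gr_class p v = gr_class p (u + v)"
proof -
  have "A_class ` S + A_class ` T = A_class ` (S + T)" for S T
  proof
    show "A_class ` S + A_class ` T \<subseteq> A_class ` (S + T)"
      by (auto elim!: set_plus_elim simp: A_class_plus intro!: imageI set_plus_intro)
    show "A_class ` (S + T) \<subseteq> A_class ` S + A_class ` T"
      by (auto elim!: set_plus_elim intro!: set_plus_intro imageI simp flip: A_class_plus)
  qed
  then show ?thesis by (simp add: gr_class_eq_image coset_plus[OF subspace_Filt])
qed

lemma gr_zero_eq: "gr_zero p = gr_class p 0"
  by (simp add: gr_zero_def gr_class_eq_image A_filt_eq)

text \<open>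
  The summand \<open>gr_zero r\<close> provides the correct value for empty \<open>A\<close>, where the sum of sets is the
  singleton of zero and not the zero coset.
\<close>

lemma gr_class_sum:
  assumes "finite A"
  shows "gr_zero r + (\<Sum>a\<in>A. gr_class r (f a)) = gr_class r (sum f A)"
  using assms
proof induction
  case (insert a A)
  have "gr_zero r + (\<Sum>a\<in>insert a A. gr_class r (f a))
      = gr_class r (f a) + (gr_zero r + (\<Sum>a\<in>A. gr_class r (f a)))"
    using insert(1,2) by (simp add: add_ac)
  also have "\<dots> = gr_class r (f a) + gr_class r (sum f A)"
    by (simp only: insert.IH)
  finally show ?case using insert(1,2) by (simp add: gr_class_plus)
qed (simp add: gr_zero_eq del: set_zero)

lemma UN_gr_class:
  assumes "\<And>f. f \<in> Filt (p - 1) \<Longrightarrow> F (A_class (u + f)) = F (A_class u)"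
  shows "(\<Union>a\<in>gr_class p u. F a) = F (A_class u)"
proof -
  have "(\<Union>a\<in>gr_class p u. F a) = (\<Union>x\<in>u +o Filt (p - 1). F (A_class x))"
    by (simp add: gr_class_eq_image)
  also have "\<dots> = F (A_class u)"
  proof (rule UN_coset[OF subspace_Filt])
    fix x assume "x - u \<in> Filt (p - 1)"
    from assms[OF this] show "F (A_class x) = F (A_class u)" by simp
  qed
  finally show ?thesis .
qed

lemma gr_part_eq: "gr_part p = gr_class p ` deg p"
proof -
  have "gr_class p u \<in> gr_class p ` deg p" if "u \<in> Filt p" for u
  proof -
    have "u - component deg u p \<in> Filt (p - 1)"
      using that
      by (auto simp: Filt_def degree.component_diff degree.component_homogeneous[OF degree.component_in])
    then have "gr_class p u = gr_class p (component deg u p)"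
      unfolding gr_class_eq_iff using Filt_subset_O_Filt by blast
    then show ?thesis using degree.component_in by blast
  qed
  moreover have "gr_part p = gr_class p ` Filt p"
    by (auto simp: gr_part_def A_filt_eq gr_class_def)
  ultimately show ?thesis using deg_subset_Filt[of p p] by auto
qed

lemma gr_part_smult_class: "gr_part_smult p c (gr_class p u) = gr_class p (c *s u)"
  unfolding gr_part_smult_def
proof (subst UN_gr_class)
  fix f assume f: "f \<in> Filt (p - 1)"
  have "c *s (u + f) - c *s u \<in> O_Filt (p - 1)"
    using subsetD[OF Filt_subset_O_Filt[OF order_refl] subspace_scale[OF subspace_Filt f]]
    by (simp add: scale_right_distrib)
  then show "A_smult c (A_class (u + f)) +o A_filt (p - 1) = A_smult c (A_class u) +o A_filt (p - 1)"
    by (simp add: A_smult_class gr_class_eq_iff flip: gr_class_def)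
qed (simp add: A_smult_class gr_class_def)

lemma gr_part_diff_class: "gr_part_diff p (gr_class p u) = gr_class (p + 1) (d u)"
  unfolding gr_part_diff_def
proof (subst UN_gr_class)
  have fold_gr: "A_class x +o A_filt p = gr_class (p + 1) x" for x by (simp add: gr_class_def)
  { fix f assume f: "f \<in> Filt (p - 1)"
    have "d (u + f) - d u \<in> O_Filt p"
      using subsetD[OF Filt_subset_O_Filt d_Filt[OF f], of p] by (simp add: d_add)
    then show "A_diff (A_class (u + f)) +o A_filt p = A_diff (A_class u) +o A_filt p"
      by (simp add: A_diff_class fold_gr gr_class_eq_iff) }
  show "A_diff (A_class u) +o A_filt p = gr_class (p + 1) (d u)"
    by (simp add: A_diff_class fold_gr)
qed

lemma gr_part_mult_class:
  assumes "u \<in> deg p" "v \<in> deg q"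
  shows "gr_part_mult p q (gr_class p u) (gr_class q v) = gr_class (p + q) (Y u (-1) v)"
proof -
  have uF: "u + f \<in> Filt p" if "f \<in> Filt (p - 1)" for f
    using that assms deg_subset_Filt[of p p] Filt_mono[of "p - 1" p]
    by (intro subspace_add[OF subspace_Filt]) auto
  have vF: "v \<in> Filt q" using assms deg_subset_Filt[of q q] by auto
  have inner: "(\<Union>b\<in>gr_class q v. A_mult (A_class x) b +o A_filt (p + q - 1)) = gr_class (p + q) (zhu_mult x v)"
    if x: "x \<in> Filt p" for x
  proof (subst UN_gr_class)
    fix g assume g: "g \<in> Filt (q - 1)"
    have "zhu_mult x g \<in> O_Filt (p + q - 1)"
      using zhu_mult_O_Filt_right[OF x subsetD[OF Filt_subset_O_Filt[OF order_refl] g]]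
      by (simp add: algebra_simps)
    then show "A_mult (A_class x) (A_class (v + g)) +o A_filt (p + q - 1)
        = A_mult (A_class x) (A_class v) +o A_filt (p + q - 1)"
      by (simp add: A_mult_class gr_class_eq_iff zhu_mult_eq zhu_prod_add_right flip: gr_class_def)
  qed (simp add: A_mult_class gr_class_def)
  have "gr_part_mult p q (gr_class p u) (gr_class q v) = gr_class (p + q) (zhu_mult u v)"
    unfolding gr_part_mult_def
  proof (subst UN_gr_class)
    show "(\<Union>b\<in>gr_class q v. A_mult (A_class u) b +o A_filt (p + q - 1)) = gr_class (p + q) (zhu_mult u v)"
      using inner[OF uF[of 0]] subspace_0[OF subspace_Filt] by simp
    fix f assume f: "f \<in> Filt (p - 1)"
    have "zhu_mult f v \<in> O_Filt (p + q - 1)"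
      using zhu_mult_O_Filt_left[OF subsetD[OF Filt_subset_O_Filt[OF order_refl] f] vF]
      by (simp add: algebra_simps)
    then show "(\<Union>b\<in>gr_class q v. A_mult (A_class (u + f)) b +o A_filt (p + q - 1))
      = (\<Union>b\<in>gr_class q v. A_mult (A_class u) b +o A_filt (p + q - 1))"
      using inner[OF uF[OF f]] inner[OF uF[of 0]] subspace_0[OF subspace_Filt]
      by (simp add: gr_class_eq_iff zhu_mult_eq zhu_prod_add_left)
  qed
  also have "\<dots> = gr_class (p + q) (Y u (-1) v)"
    unfolding gr_class_eq_iff zhu_mult_eq
    by (rule subsetD[OF Filt_subset_O_Filt zhu_prod_degree(2)[OF assms]]) simp
  finally show ?thesis .
qed

lemma supercommutator_swap:
  assumes "u \<in> deg p" "v \<in> deg q"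
  shows "supercommutator q u v = (- ((-1) powi (p * q))) *s supercommutator p v u"
proof -
  have "((-1) powi (p * q)) * ((-1) powi (q * p)) = (1 :: complex)"
    by (auto simp: power_int_minus_left)
  then show ?thesis
    unfolding supercommutator_homogeneous[OF assms(1)] supercommutator_homogeneous[OF assms(2)]
    by (simp add: scale_right_diff_distrib)
qed

lemma supercommutator_cong_left:
  assumes "u - u' \<in> O_Filt (p - 1)" "v \<in> deg q"
  shows "supercommutator q u v - supercommutator q u' v \<in> O_Filt (p + q - 3)"
  using supercommutator_O_Filt[OF assms] supercommutator_add[of q "u - u'" u' v] by simp

text \<open>
  Every pair of homogeneous representatives has a supercommutator with the same leading term: the
  first argument is exchanged directly, the second after swapping the arguments.
\<close>

lemma gr_part_bracket_class:
  assumes u: "u \<in> deg p" and v: "v \<in> deg q"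
  shows "gr_part_bracket p q (gr_class p u) (gr_class q v) = gr_class (p + q - 2) (Y u 0 v)"
proof -
  have summand: "(A_mult (A_class x) (A_class y) + A_smult (- ((-1) powi (p * q))) (A_mult (A_class y) (A_class x)))
      +o A_filt (p + q - 3) = gr_class (p + q - 2) (Y u 0 v)"
    if x: "x \<in> deg p" "gr_class p x = gr_class p u" and y: "y \<in> deg q" "gr_class q y = gr_class q v" for x y
  proof -
    note S_add = subspace_add[OF subspace_O_Filt]
    have 1: "supercommutator q x y - supercommutator q u y \<in> O_Filt (p + q - 3)"
      using x y by (intro supercommutator_cong_left) (auto simp: gr_class_eq_iff)
    have "supercommutator p y u - supercommutator p v u \<in> O_Filt (q + p - 3)"
      using u y by (intro supercommutator_cong_left) (auto simp: gr_class_eq_iff)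
    from subspace_scale[OF subspace_O_Filt this, of "- ((-1) powi (p * q))"]
    have 2: "supercommutator q u y - supercommutator q u v \<in> O_Filt (p + q - 3)"
      unfolding supercommutator_swap[OF u y(1)] supercommutator_swap[OF u v]
      by (simp add: scale_right_diff_distrib add.commute)
    have "supercommutator q x y - Y u 0 v \<in> O_Filt (p + q - 3)"
      using S_add[OF S_add[OF 1 2] supercommutator_leading[OF u v]] by simp
    moreover have "(A_mult (A_class x) (A_class y) + A_smult (- ((-1) powi (p * q))) (A_mult (A_class y) (A_class x)))
        +o A_filt (p + q - 3) = gr_class (p + q - 2) (supercommutator q x y)"
      by (simp add: A_mult_class A_smult_class A_class_plus gr_class_def
          supercommutator_homogeneous[OF x(1)])
    ultimately show ?thesis by (simp add: gr_class_eq_iff)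
  qed
  show ?thesis
    unfolding gr_part_bracket_def
  proof (intro SUP_eq_const)
    show "{x \<in> deg p. gr_class p x = gr_class p u} \<noteq> {}" "{y \<in> deg q. gr_class q y = gr_class q v} \<noteq> {}"
      using u v by auto
  qed (use summand in auto)
qed

section \<open>The symbol map\<close>

text \<open>
  The composition of the projection \<open>V \<rightarrow> R(V)\<close> with \<open>\<eta>\<close>.
\<close>

definition gr_symbol :: "'v \<Rightarrow> int \<Rightarrow> 'v set set" where
  "gr_symbol u = (\<lambda>p. gr_class p (component deg u p))"

lemma eta_R_class: "eta (R_class u) = gr_symbol u"
  unfolding eta_def gr_symbol_def
proof
  fix p
  show "(\<Union>x\<in>R_class u. gr_class p (component deg x p)) = gr_class p (component deg u p)"
    by (rule UN_R_class)
      (simp add: gr_class_eq_iff C2_component_O_Filt flip: degree.component_diff)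
qed

lemma gr_symbol_homogeneous: "u \<in> deg p \<Longrightarrow> gr_symbol u = gr_inj p (gr_class p u)"
  by (rule ext) (simp add: gr_symbol_def gr_inj_def degree.component_homogeneous gr_zero_eq)

text \<open>
  The operations of \<open>gr A(V)\<close> sum over the degrees in which the symbol of \<open>u\<close> is nonzero, whereas
  \<open>u\<^sub>n v\<close> sums over the degrees in which \<open>u\<close> itself has a component. A component whose class vanishes
  contributes the zero class, since the operation \<open>F\<close> depends on classes only.
\<close>

lemma gr_symbol_Y:
  assumes F: "\<And>p q u v. u \<in> deg p \<Longrightarrow> v \<in> deg q \<Longrightarrow>
    F p q (gr_class p u) (gr_class q v) = gr_class (p + q - 2 * n - 2) (Y u n v)"
  shows "gr_zero r + (\<Sum>p | gr_symbol u p \<noteq> gr_zero p. F p (r + 2 * n + 2 - p) (gr_symbol u p) (gr_symbol v (r + 2 * n + 2 - p)))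
    = gr_symbol (Y u n v) r"
proof -
  define x where "x p = Y (component deg u p) n (component deg v (r + 2 * n + 2 - p))" for p
  let ?A = "{p. component deg u p \<noteq> 0}" and ?B = "{p. gr_symbol u p \<noteq> gr_zero p}"
  have F': "F p (r + 2 * n + 2 - p) (gr_symbol u p) (gr_symbol v (r + 2 * n + 2 - p)) = gr_class r (x p)" for p
    unfolding gr_symbol_def x_def
    using F[OF degree.component_in[of u p] degree.component_in[of v "r + 2 * n + 2 - p"]] by simp
  have sub: "?B \<subseteq> ?A" by (auto simp: gr_symbol_def gr_zero_eq)
  have "x p \<in> O_Filt (r - 1)" if "p \<notin> ?B" for p
  proof -
    have "gr_class r (x p) = F p (r + 2 * n + 2 - p) (gr_class p 0) (gr_symbol v (r + 2 * n + 2 - p))"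
      using that F'[of p] by (simp add: gr_zero_eq)
    also have "\<dots> = gr_class r 0"
      unfolding gr_symbol_def
      using F[OF subspace_0[OF deg_subspace[of p]] degree.component_in[of v "r + 2 * n + 2 - p"]]
      by (simp add: undeformed.P_zero_left)
    finally show ?thesis by (simp add: gr_class_eq_iff)
  qed
  then have "sum x (?A - ?B) \<in> O_Filt (r - 1)"
    by (intro subspace_sum[OF subspace_O_Filt]) auto
  moreover have "sum x ?A = sum x (?A - ?B) + sum x ?B"
    by (rule sum.subset_diff[OF sub degree.finite_component])
  ultimately have "gr_class r (sum x ?A) = gr_class r (sum x ?B)"
    by (simp add: gr_class_eq_iff)
  moreover have "gr_zero r + (\<Sum>p\<in>?B. gr_class r (x p)) = gr_class r (sum x ?B)"
    using sub degree.finite_component finite_subset by (intro gr_class_sum) blast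
  moreover have "gr_symbol (Y u n v) r = gr_class r (sum x ?A)"
    by (simp add: gr_symbol_def x_def component_Y)
  ultimately show ?thesis by (simp add: F')
qed

lemma carrier_gr_algebra: "carrier gr_algebra = range gr_symbol"
proof
  show "range gr_symbol \<subseteq> carrier gr_algebra"
  proof
    fix f assume "f \<in> range gr_symbol"
    then obtain u where u: "f = gr_symbol u" by blast
    have "{p. gr_symbol u p \<noteq> gr_zero p} \<subseteq> {p. component deg u p \<noteq> 0}" by (auto simp: gr_symbol_def gr_zero_eq)
    then have "finite {p. gr_symbol u p \<noteq> gr_zero p}" using degree.finite_component finite_subset by blast
    then show "f \<in> carrier gr_algebra"
      by (auto simp: gr_algebra_def u gr_part_eq gr_symbol_def degree.component_in)
  qed
  show "carrier gr_algebra \<subseteq> range gr_symbol"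
  proof
    fix f assume "f \<in> carrier gr_algebra"
    then have f: "f p \<in> gr_class p ` deg p" and fin: "finite {p. f p \<noteq> gr_zero p}" for p
      by (auto simp: gr_algebra_def gr_part_eq)
    have "\<exists>x. x \<in> deg p \<and> f p = gr_class p x \<and> (f p = gr_zero p \<longrightarrow> x = 0)" for p
      using f[of p] subspace_0[OF deg_subspace, of p] gr_zero_eq[of p] by (cases "f p = gr_zero p") auto
    then obtain x where x: "\<And>p. x p \<in> deg p" "\<And>p. f p = gr_class p (x p)"
      "\<And>p. f p = gr_zero p \<Longrightarrow> x p = 0" by metis
    have "component deg (sum x {p. f p \<noteq> gr_zero p}) = x"
      by (rule degree.component_superset_eqI[OF fin]) (use x in auto)
    then have "f = gr_symbol (sum x {p. f p \<noteq> gr_zero p})" by (auto simp: gr_symbol_def x)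
    then show "f \<in> range gr_symbol" by blast
  qed
qed

lemma poisson_quotient_gr: "poisson_quotient scale deg d Y vac gr_algebra gr_symbol"
proof unfold_locales
  fix u v :: 'v and c :: complex and p :: int
  show "carrier gr_algebra = range gr_symbol" by (rule carrier_gr_algebra)
  show "gr_symbol u \<oplus>\<^bsub>gr_algebra\<^esub> gr_symbol v = gr_symbol (u + v)"
    by (simp add: gr_algebra_def gr_symbol_def gr_class_plus degree.component_add)
  show "gr_symbol u \<otimes>\<^bsub>gr_algebra\<^esub> gr_symbol v = gr_symbol (Y u (-1) v)"
    using gr_symbol_Y[of gr_part_mult "-1"] by (simp add: gr_algebra_def gr_part_mult_class)
  show "pbracket gr_algebra (gr_symbol u) (gr_symbol v) = gr_symbol (Y u 0 v)"
    using gr_symbol_Y[of gr_part_bracket 0] by (simp add: gr_algebra_def gr_part_bracket_class)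
  show "\<one>\<^bsub>gr_algebra\<^esub> = gr_symbol vac"
    by (simp add: gr_algebra_def gr_symbol_homogeneous[OF vac_degree])
  have zero: "\<zero>\<^bsub>gr_algebra\<^esub> = gr_zero" by (simp add: gr_algebra_def)
  show "\<zero>\<^bsub>gr_algebra\<^esub> = gr_symbol 0"
    by (auto simp: zero gr_symbol_def gr_zero_eq degree.component_0)
  show "c \<odot>\<^bsub>gr_algebra\<^esub> gr_symbol u = gr_symbol (c *s u)"
    by (simp add: gr_algebra_def gr_symbol_def gr_part_smult_class degree.component_scale)
  show "hpart gr_algebra p = gr_symbol ` deg p"
    by (simp add: gr_algebra_def gr_part_eq image_image gr_symbol_homogeneous cong: image_cong)
  show "dgdiff gr_algebra (gr_symbol u) = gr_symbol (d u)"
  proof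
    fix q
    show "dgdiff gr_algebra (gr_symbol u) q = gr_symbol (d u) q"
      using component_d[of u "q - 1"] gr_part_diff_class[of "q - 1" "component deg u (q - 1)"]
      by (simp add: gr_algebra_def gr_symbol_def)
  qed
  show "gr_symbol u = \<zero>\<^bsub>gr_algebra\<^esub>" if "u \<in> C2"
    using that by (intro ext) (simp add: zero gr_symbol_def gr_zero_eq gr_class_eq_iff C2_component_O_Filt)
  show "gr_symbol (component deg u p) = \<zero>\<^bsub>gr_algebra\<^esub>" if "gr_symbol u = \<zero>\<^bsub>gr_algebra\<^esub>"
  proof
    fix q
    show "gr_symbol (component deg u p) q = \<zero>\<^bsub>gr_algebra\<^esub> q"
      using fun_cong[OF that, of p]
      by (auto simp: zero gr_symbol_def gr_zero_eq degree.component_homogeneous[OF degree.component_in])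
  qed
qed

end

theorem proposition6p10:
  fixes scale :: "complex \<Rightarrow> 'v::ab_group_add \<Rightarrow> 'v"
    and deg :: "int \<Rightarrow> 'v set"
    and d :: "'v \<Rightarrow> 'v"
    and Y :: "'v \<Rightarrow> int \<Rightarrow> 'v \<Rightarrow> 'v"
    and vac \<omega> :: 'v
  assumes "dg_vertex_operator_algebra scale deg d Y vac \<omega>"
  defines "R \<equiv> dg_vertex_algebra.R_algebra scale deg d Y vac"
    and "grA \<equiv> dg_vertex_operator_algebra.gr_algebra scale deg d Y vac \<omega>"
    and "\<eta> \<equiv> dg_vertex_operator_algebra.eta scale deg Y \<omega>"
  shows "(\<forall>p. \<forall>u\<in>deg p.
            \<eta> (dg_vertex_algebra.R_class scale Y u) =
              dg_vertex_operator_algebra.gr_inj scale deg Y \<omega> p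
                (dg_vertex_operator_algebra.gr_class scale deg Y \<omega> p u))
         \<and> dg_poisson_morphism (-2) R grA \<eta>
         \<and> \<eta> ` carrier R = carrier grA"
proof -
  interpret V: dg_vertex_operator_algebra scale deg d Y vac \<omega> by (rule assms(1))
  interpret R: poisson_quotient scale deg d Y vac R V.R_class
    unfolding R_def by (rule V.poisson_quotient_R)
  interpret grA: poisson_quotient scale deg d Y vac grA V.gr_symbol
    unfolding grA_def by (rule V.poisson_quotient_gr)
  have eta: "\<eta> (V.R_class u) = V.gr_symbol u" for u
    unfolding \<eta>_def by (rule V.eta_R_class)
  have surj: "\<eta> ` carrier R = carrier grA"
    by (simp add: R.carrier_eq grA.carrier_eq image_image eta)
  have "dg_poisson_morphism (-2) R grA \<eta>"
  proof (intro dg_poisson_morphism.intro dg_poisson_morphism_axioms.intro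
      R.dg_poisson_algebra grA.dg_poisson_algebra)
    show "\<eta> \<in> ring_hom R grA"
    proof (rule ring_hom_memI)
      show "\<eta> x \<in> carrier grA" if "x \<in> carrier R" for x using that surj by blast
    qed (auto simp: R.carrier_eq R.pi_mult R.pi_add R.pi_one eta grA.pi_mult grA.pi_add grA.pi_one)
  qed (auto simp: R.carrier_eq R.pi_smult R.pi_hpart R.pi_diff R.pi_bracket eta
      grA.pi_smult grA.pi_hpart grA.pi_diff grA.pi_bracket)
  moreover have "\<eta> (V.R_class u) = V.gr_inj p (V.gr_class p u)" if "u \<in> deg p" for p u
    by (simp add: eta V.gr_symbol_homogeneous[OF that])
  ultimately show ?thesis using surj by blast
qed

end
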